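(* Fix parameters $V>0$ and $\delta>0$ and run the online renewal optimization algorithm described in the context on a renewal system satisfying Assumptions 1–5 of the context. Then all constraints of the opportunistic scheduling problem are satisfied with probability 1; that is, $\alpha[n]\in\mathcal{A}$ for all $n$ and, with probability 1, $$\limsup_{N\to\infty}\frac{\sum_{n=0}^{N-1}z_l[n]}{\sum_{n=0}^{N-1}T[n]}\le c_l\qquad\text{for all } l\in\{1,\dots,L\}.$$
   Context: **System.** Time is divided into frames $n=0,1,2,\dots$. At the start of frame $n$ a controller observes $\omega[n]$, where the $\omega[n]$ are i.i.d. copies of a random variable with values in a compact set $\Omega\subset\mathbb{R}^q$, and then chooses an action $\alpha[n]\in\mathcal{A}$ (based on $\omega[n]$ and the past, possibly with independent randomization). The pair $(\omega[n],\alpha[n])$ induces random variables: a penalty $y[n]$, a frame length $T[n]$, and a resource vector $\mathbf{z}[n]=(z_1[n],\dots,z_L[n])$. Given $\alpha[n]=\alpha$ and $\omega[n]=\omega$, the vector $(y[n],T[n],\mathbf{z}[n])$ is independent of the outcomes of previous frames, with conditional expectations $\hat y(\omega,\alpha)=\mathbb{E}[y[n]\mid\omega,\alpha]$, $\hat T(\omega,\alpha)=\mathbb{E}[T[n]\mid\omega,\alpha]$, $\hat{\mathbf z}(\omega,\alpha)=\mathbb{E}[\mathbf z[n]\mid\omega,\alpha]$ that are deterministic functions of $(\omega,\alpha)$. Policies are assumed measurable so that all these are valid random variables. Let $c_1,\dots,c_L\ge 0$ be constants and $K[n]=\sqrt{\sum_{l=1}^L(z_l[n]-c_lT[n])^2}$.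 **Optimization problem.** Minimize $\limsup_{N\to\infty}\frac{\sum_{n<N}y[n]}{\sum_{n<N}T[n]}$ subject to $\limsup_{N\to\infty}\frac{\sum_{n<N}z_l[n]}{\sum_{n<N}T[n]}\le c_l$ for all $l$, and $\alpha[n]\in\mathcal{A}$ for all $n$, the minimum and the constraints being taken in the almost sure sense. Its optimal objective is denoted $\theta^*$ (the smallest value of the objective, in the almost sure sense, over policies satisfying the constraints almost surely). **Randomized stationary policy.** A policy that, at each frame $n$, after observing $\omega[n]$, chooses $\alpha^*[n]$ according to a conditional probability given $\omega[n]$ that is the same for all $n$. **Assumptions.** 1. (Exponential type) Given $\omega[n]=\omega$ and $\alpha[n]=\alpha$, $T[n]\ge1$ with probability 1, and there are constants $\eta>0$, $B>0$ with $\mathbb{E}[e^{\eta|X|}\mid\omega,\alpha]\le B+1$ for $X=y[n],K[n],T[n]$, for all $\omega\in\Omega,\alpha\in\mathcal{A}$. 2. There is a positive constant $\theta_{\max}$ with $\theta^*\in[0,\theta_{\max})$ with probability 1. 3. For each fixed $\omega\in\Omega$, the set $\{(\hat y(\omega,\alpha),\hat T(\omega,\alpha),\hat{\mathbf z}(\omega,\alpha)):\alpha\in\mathcal{A}\}$ is compact. 4. The set $\mathcal{R}\subseteq\mathbb{R}^{L+2}$ of all one-shot averages $\mathbb{E}[(\hat y(\omega[0],\alpha^*[0]),\hat T(\omega[0],\alpha^*[0]),\hat{\mathbf z}(\omega[0],\alpha^*[0]))]$ over randomized stationary policies is bounded. 5. ($\xi$-slackness) There are $\xi>0$ and a randomized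 stationary policy $\alpha^{(\xi)}[n]$ with $\mathbb{E}[\hat z_l(\omega[n],\alpha^{(\xi)}[n])]/\mathbb{E}[\hat T(\omega[n],\alpha^{(\xi)}[n])]=c_l-\xi$ for all $l$. **Algorithm** (parameters $V>0$, $\delta>0$). Let $[x]_0^{\theta_{\max}}=\min\{\max\{x,0\},\theta_{\max}\}$. Initialize $Q_l[0]=0$ for all $l$ and $\theta[0]=0$. At each frame $n$: - observe $Q_l[n]$, $\theta[n]$, $\omega[n]$ and choose $\alpha[n]\in\mathcal{A}$ minimizing $\mathbb{E}\big[V(y[n]-\theta[n]T[n])+\sum_{l=1}^LQ_l[n](z_l[n]-c_lT[n])\,\big|\,Q_l[n],\theta[n],\omega[n]\big]$, equivalently minimizing over $\alpha\in\mathcal A$ the quantity $V(\hat y(\omega[n],\alpha)-\theta[n]\hat T(\omega[n],\alpha))+\sum_{l}Q_l[n](\hat z_l(\omega[n],\alpha)-c_l\hat T(\omega[n],\alpha))$; - update $\theta[n+1]=\Big[\frac{1}{(n+1)^\delta}\sum_{i=0}^n\big(y[i]-\theta[i]T[i]+\frac1V\sum_{l=1}^LQ_l[i](z_l[i]-c_lT[i])\big)\Big]_0^{\theta_{\max}}$; - update $Q_l[n+1]=\max\{Q_l[n]+z_l[n]-c_lT[n],0\}$ for $l=1,\dots,L$. *)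

theory Defs
  imports "HOL-Probability.Probability"
begin

type_synonym 'l outcome = "real \<times> real \<times> (real ^ 'l)"
type_synonym ('q, 'a, 'l) frame = "(real ^ 'q) \<times> 'a \<times> 'l outcome"

text \<open>
  The compact set of states is \<open>space (state_law S)\<close> and the action set is \<open>space (actions S)\<close>.
  \<open>outcome_law S n (\<omega>, \<alpha>)\<close> is the law of (penalty, frame length, resources) in frame
  \<open>n\<close> given state \<open>\<omega>\<close> and action \<open>\<alpha>\<close>. It may depend on \<open>n\<close>; only its means
  \<open>yhat\<close>, \<open>That\<close>, \<open>zhat\<close> have to be the same functions of \<open>(\<omega>, \<alpha>)\<close> in every
  frame.
\<close>

record ('q, 'a, 'l) renewal_system =
  state_law :: "(real ^ 'q::finite) measure"
  actions :: "'a measure"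
  outcome_law :: "nat \<Rightarrow> (real ^ 'q) \<times> 'a \<Rightarrow> ('l::finite) outcome measure"
  yhat :: "real ^ 'q \<Rightarrow> 'a \<Rightarrow> real"
  That :: "real ^ 'q \<Rightarrow> 'a \<Rightarrow> real"
  zhat :: "real ^ 'q \<Rightarrow> 'a \<Rightarrow> real ^ 'l"
  bound :: "real ^ 'l"

definition is_renewal_system :: "('q::finite, 'a, 'l::finite) renewal_system \<Rightarrow> bool" where
  "is_renewal_system S \<longleftrightarrow>
     prob_space (state_law S) \<and>
     compact (space (state_law S)) \<and>
     sets (state_law S) = sets (restrict_space borel (space (state_law S))) \<and>
     (\<forall>n. outcome_law S n \<in> state_law S \<Otimes>\<^sub>M actions S \<rightarrow>\<^sub>M prob_algebra borel) \<and>
     (\<forall>n. \<forall>\<omega>\<in>space (state_law S). \<forall>\<alpha>\<in>space (actions S).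
        has_bochner_integral (outcome_law S n (\<omega>, \<alpha>)) (\<lambda>(y, T, z). y) (yhat S \<omega> \<alpha>) \<and>
        has_bochner_integral (outcome_law S n (\<omega>, \<alpha>)) (\<lambda>(y, T, z). T) (That S \<omega> \<alpha>) \<and>
        has_bochner_integral (outcome_law S n (\<omega>, \<alpha>)) (\<lambda>(y, T, z). z) (zhat S \<omega> \<alpha>)) \<and>
     (\<forall>l. 0 \<le> bound S $ l)"

definition history ::
  "(nat \<Rightarrow> 'p \<Rightarrow> real ^ 'q::finite) \<Rightarrow> (nat \<Rightarrow> 'p \<Rightarrow> 'a) \<Rightarrow> (nat \<Rightarrow> 'p \<Rightarrow> real) \<Rightarrow>
   (nat \<Rightarrow> 'p \<Rightarrow> real) \<Rightarrow> (nat \<Rightarrow> 'p \<Rightarrow> real ^ 'l::finite) \<Rightarrow> nat \<Rightarrow> 'p \<Rightarrow> nat \<Rightarrow> ('q, 'a, 'l) frame"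
where
  "history \<omega> \<alpha> y T z n x = (\<lambda>i\<in>{..<n}. (\<omega> i x, \<alpha> i x, y i x, T i x, z i x))"

definition history_space ::
  "('q::finite, 'a, 'l::finite) renewal_system \<Rightarrow> nat \<Rightarrow> (nat \<Rightarrow> ('q, 'a, 'l) frame) measure"
where
  "history_space S n = PiM {..<n} (\<lambda>_. state_law S \<Otimes>\<^sub>M actions S \<Otimes>\<^sub>M borel)"

text \<open>
  Operation of the system on a probability space \<open>M\<close> under some policy. The action
  \<open>\<alpha> n\<close> may have any joint law with the past frames and \<open>\<omega> n\<close>, so it is an
  arbitrary, possibly randomized, causal choice: each state has law \<open>state_law S\<close>
  and is independent of all earlier frames, including earlier actions (so the states are i.i.d.), and given the past, \<open>\<omega> n\<close> and \<open>\<alpha> n\<close>, the outcome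
  of frame \<open>n\<close> has regular conditional distribution \<open>outcome_law S n (\<omega> n, \<alpha> n)\<close>.
\<close>

definition system_run ::
  "('q::finite, 'a, 'l::finite) renewal_system \<Rightarrow> 'p measure \<Rightarrow>
   (nat \<Rightarrow> 'p \<Rightarrow> real ^ 'q) \<Rightarrow> (nat \<Rightarrow> 'p \<Rightarrow> 'a) \<Rightarrow> (nat \<Rightarrow> 'p \<Rightarrow> real) \<Rightarrow>
   (nat \<Rightarrow> 'p \<Rightarrow> real) \<Rightarrow> (nat \<Rightarrow> 'p \<Rightarrow> real ^ 'l) \<Rightarrow> bool"
where
  "system_run S M \<omega> \<alpha> y T z \<longleftrightarrow>
     prob_space M \<and>
     (\<forall>n. \<omega> n \<in> M \<rightarrow>\<^sub>M state_law S \<and> \<alpha> n \<in> M \<rightarrow>\<^sub>M actions S \<and>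
          y n \<in> borel_measurable M \<and> T n \<in> borel_measurable M \<and> z n \<in> borel_measurable M) \<and>
     (\<forall>n. distr M (history_space S n \<Otimes>\<^sub>M state_law S) (\<lambda>x. (history \<omega> \<alpha> y T z n x, \<omega> n x))
          = distr M (history_space S n) (history \<omega> \<alpha> y T z n) \<Otimes>\<^sub>M state_law S) \<and>
     (\<forall>n. \<forall>E \<in> sets (history_space S n \<Otimes>\<^sub>M state_law S \<Otimes>\<^sub>M actions S). \<forall>B \<in> sets borel.
        emeasure M {x \<in> space M. (history \<omega> \<alpha> y T z n x, \<omega> n x, \<alpha> n x) \<in> E \<and>
                                 (y n x, T n x, z n x) \<in> B}
        = (\<integral>\<^sup>+x. indicator E (history \<omega> \<alpha> y T z n x, \<omega> n x, \<alpha> n x)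
                 * emeasure (outcome_law S n (\<omega> n x, \<alpha> n x)) B \<partial>M))"

definition constraints_satisfied ::
  "('q::finite, 'a, 'l::finite) renewal_system \<Rightarrow> 'p measure \<Rightarrow>
   (nat \<Rightarrow> 'p \<Rightarrow> 'a) \<Rightarrow> (nat \<Rightarrow> 'p \<Rightarrow> real) \<Rightarrow> (nat \<Rightarrow> 'p \<Rightarrow> real ^ 'l) \<Rightarrow> bool"
where
  "constraints_satisfied S M \<alpha> T z \<longleftrightarrow>
     (\<forall>n. \<forall>x\<in>space M. \<alpha> n x \<in> space (actions S)) \<and>
     (AE x in M. \<forall>l. limsup (\<lambda>N. ereal ((\<Sum>n<N. z n x $ l) / (\<Sum>n<N. T n x)))
                       \<le> ereal (bound S $ l))"

text \<open>
  The sample space is taken to be the space of frame sequences with the coordinate process: this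
  loses no policy, since any run can be replaced by the law of its sequence of frames. The
  value is \<open>\<infinity>\<close> if no policy is feasible.
\<close>

definition optimal_objective :: "('q::finite, 'a, 'l::finite) renewal_system \<Rightarrow> ereal" where
  "optimal_objective S = Inf {\<theta>. \<exists>D :: (nat \<Rightarrow> ('q, 'a, 'l) frame) measure.
     let \<omega> = (\<lambda>n f. fst (f n));
         \<alpha> = (\<lambda>n f. fst (snd (f n)));
         y = (\<lambda>n f. fst (snd (snd (f n))));
         T = (\<lambda>n f. fst (snd (snd (snd (f n)))));
         z = (\<lambda>n f. snd (snd (snd (snd (f n)))))
     in system_run S D \<omega> \<alpha> y T z \<and>
        constraints_satisfied S D \<alpha> T z \<and>
        (AE f in D. limsup (\<lambda>N. ereal ((\<Sum>n<N. y n f) / (\<Sum>n<N. T n f))) \<le> \<theta>)}"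

definition stationary_policy ::
  "('q::finite, 'a, 'l::finite) renewal_system \<Rightarrow> (real ^ 'q \<Rightarrow> 'a measure) \<Rightarrow> bool"
where
  "stationary_policy S \<pi> \<longleftrightarrow> \<pi> \<in> state_law S \<rightarrow>\<^sub>M prob_algebra (actions S)"

definition one_shot_average ::
  "('q::finite, 'a, 'l::finite) renewal_system \<Rightarrow> (real ^ 'q \<Rightarrow> 'a measure) \<Rightarrow>
   (real ^ 'q \<Rightarrow> 'a \<Rightarrow> 'b::{banach, second_countable_topology}) \<Rightarrow> 'b"
where
  "one_shot_average S \<pi> g = (\<integral>\<omega>. (\<integral>\<alpha>. g \<omega> \<alpha> \<partial>\<pi> \<omega>) \<partial>state_law S)"

definition exponential_type :: "('q::finite, 'a, 'l::finite) renewal_system \<Rightarrow> bool" where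
  "exponential_type S \<longleftrightarrow> (\<exists>\<eta>>0. \<exists>B>0.
     \<forall>n. \<forall>\<omega>\<in>space (state_law S). \<forall>\<alpha>\<in>space (actions S).
       let P = outcome_law S n (\<omega>, \<alpha>) in
       (AE (y, T, z) in P. 1 \<le> T) \<and>
       (\<integral>\<^sup>+(y, T, z). ennreal (exp (\<eta> * \<bar>y\<bar>)) \<partial>P) \<le> ennreal (B + 1) \<and>
       (\<integral>\<^sup>+(y, T, z). ennreal (exp (\<eta> * \<bar>sqrt (\<Sum>l\<in>UNIV. (z $ l - bound S $ l * T)\<^sup>2)\<bar>)) \<partial>P)
         \<le> ennreal (B + 1) \<and>
       (\<integral>\<^sup>+(y, T, z). ennreal (exp (\<eta> * \<bar>T\<bar>)) \<partial>P) \<le> ennreal (B + 1))"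

definition compact_means :: "('q::finite, 'a, 'l::finite) renewal_system \<Rightarrow> bool" where
  "compact_means S \<longleftrightarrow> (\<forall>\<omega>\<in>space (state_law S).
     compact ((\<lambda>\<alpha>. (yhat S \<omega> \<alpha>, That S \<omega> \<alpha>, zhat S \<omega> \<alpha>)) ` space (actions S)))"

definition bounded_averages :: "('q::finite, 'a, 'l::finite) renewal_system \<Rightarrow> bool" where
  "bounded_averages S \<longleftrightarrow>
     bounded {one_shot_average S \<pi> (\<lambda>\<omega> \<alpha>. (yhat S \<omega> \<alpha>, That S \<omega> \<alpha>, zhat S \<omega> \<alpha>)) | \<pi>.
              stationary_policy S \<pi>}"

definition xi_slackness :: "('q::finite, 'a, 'l::finite) renewal_system \<Rightarrow> bool" where
  "xi_slackness S \<longleftrightarrow> (\<exists>\<xi>>0. \<exists>\<pi>. stationary_policy S \<pi> \<and>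
     (\<forall>l. one_shot_average S \<pi> (\<lambda>\<omega> \<alpha>. zhat S \<omega> \<alpha> $ l) / one_shot_average S \<pi> (That S)
            = bound S $ l - \<xi>))"

text \<open>
  Queues and ratio estimates as functions of the outcome sequences along one sample path;
  \<open>c\<close> is the vector of constraint constants.
\<close>

primrec queue ::
  "real ^ 'l::finite \<Rightarrow> (nat \<Rightarrow> real) \<Rightarrow> (nat \<Rightarrow> real ^ 'l) \<Rightarrow> nat \<Rightarrow> real ^ 'l"
where
  "queue c T z 0 = 0"
| "queue c T z (Suc n) = (\<chi> l. max (queue c T z n $ l + z n $ l - c $ l * T n) 0)"

fun ratio_estimate ::
  "real ^ 'l::finite \<Rightarrow> real \<Rightarrow> real \<Rightarrow> real \<Rightarrow>
   (nat \<Rightarrow> real) \<Rightarrow> (nat \<Rightarrow> real) \<Rightarrow> (nat \<Rightarrow> real ^ 'l) \<Rightarrow> nat \<Rightarrow> real"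
where
  "ratio_estimate c V \<delta> \<theta>max y T z 0 = 0"
| "ratio_estimate c V \<delta> \<theta>max y T z (Suc n) =
     min (max (1 / (real (n + 1) powr \<delta>) *
                (\<Sum>i=0..n. y i - ratio_estimate c V \<delta> \<theta>max y T z i * T i
                   + 1 / V * (\<Sum>l\<in>UNIV. queue c T z i $ l * (z i $ l - c $ l * T i)))) 0) \<theta>max"

text \<open>
  Any rule for breaking ties among minimizing actions is allowed. The requirement is almost sure
  so that it is meaningful for the coordinate process on a space of sequences.
\<close>

definition follows_algorithm ::
  "('q::finite, 'a, 'l::finite) renewal_system \<Rightarrow> real \<Rightarrow> real \<Rightarrow> real \<Rightarrow> 'p measure \<Rightarrow>
   (nat \<Rightarrow> 'p \<Rightarrow> real ^ 'q) \<Rightarrow> (nat \<Rightarrow> 'p \<Rightarrow> 'a) \<Rightarrow> (nat \<Rightarrow> 'p \<Rightarrow> real) \<Rightarrow>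
   (nat \<Rightarrow> 'p \<Rightarrow> real) \<Rightarrow> (nat \<Rightarrow> 'p \<Rightarrow> real ^ 'l) \<Rightarrow> bool"
where
  "follows_algorithm S V \<delta> \<theta>max M \<omega> \<alpha> y T z \<longleftrightarrow>
     (AE x in M. \<forall>n.
        let Q = queue (bound S) (\<lambda>i. T i x) (\<lambda>i. z i x) n;
            \<theta> = ratio_estimate (bound S) V \<delta> \<theta>max (\<lambda>i. y i x) (\<lambda>i. T i x) (\<lambda>i. z i x) n
        in is_arg_min
             (\<lambda>a. V * (yhat S (\<omega> n x) a - \<theta> * That S (\<omega> n x) a)
                  + (\<Sum>l\<in>UNIV. Q $ l * (zhat S (\<omega> n x) a $ l - bound S $ l * That S (\<omega> n x) a)))
             (\<lambda>a. a \<in> space (actions S)) (\<alpha> n x))"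

end

theory Submission
  imports Defs "HOL-Library.Discrete_Functions"
begin

text \<open>
  Queue \<open>l\<close> absorbs every violation of constraint \<open>l\<close>, so the claim follows once
  \<open>Q\<^sub>l[n] / n \<longlonglongrightarrow> 0\<close> almost surely. The estimate \<open>\<theta>[n]\<close> stays in
  \<open>[0, \<theta>max]\<close>, so comparing the chosen action with the slack policy bounds
  \<open>\<Sum>\<^sub>l E[Q\<^sub>l[n] (z\<^sub>l[n] - c\<^sub>l T[n])]\<close> by a constant. Together with bounded
  second moments of the increments this gives \<open>E[Q\<^sub>l[n]\<^sup>2] \<le> C n\<close>. Hence \<open>Q\<^sub>l[k\<^sup>2] / k\<^sup>2\<close>
  has second moment \<open>O(1 / k\<^sup>2)\<close> and tends to \<open>0\<close>; the oscillation of \<open>Q\<^sub>l\<close> between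
  consecutive squares is a sum of \<open>2 k + 1\<close> increments and is bounded in the same way.
\<close>

text \<open>The model prescribes the law of an outcome given history, state and action, and only on
  rectangles; it also makes the fresh state independent of the history. The joint law of the action
  with the past is left open. So expectations are computed by two devices: replacing an outcome by
  its mean given the decision, and factoring a function of the history times a function of the
  current state. The slack policy is never run on the sample space: the pointwise comparison with an
  arbitrary action is averaged over the policy's kernel at the current state, which leaves a
  function of that state alone. The algorithm minimises a weighted sum over all queues, so only the
  drift of the sum of squares is controlled, and a single queue is bounded through that sum. The
  passage to squares is forced: along all \<open>n\<close> the second moment of
  \<open>Q[n] / n\<close> is only known to be O(1/n), which is not summable. It costs blocks of 2k+1
  increments, whose sum has second moment O(k^2), the same order as that of
  \<open>Q[k^2]\<close>.\<close>

section \<open>Integration along a conditional law, and products of independent factors\<close>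

text \<open>\<open>U\<close> is what is known before the outcome \<open>X\<close>, and
  \<open>\<kappa>\<close> is the conditional law. The hypothesis \<open>rect\<close> is the case of
  two indicators; two inductions over measurable functions extend it to products, one in each
  factor.\<close>

lemma disintegrate_nn_integral:
  fixes f :: "'u \<Rightarrow> ennreal" and g :: "'o \<Rightarrow> ennreal"
  assumes U[measurable]: "U \<in> M \<rightarrow>\<^sub>M N" and X[measurable]: "X \<in> M \<rightarrow>\<^sub>M R"
    and k[measurable]: "\<kappa> \<in> N \<rightarrow>\<^sub>M subprob_algebra R"
    and rect: "\<And>E B. E \<in> sets N \<Longrightarrow> B \<in> sets R \<Longrightarrow>
      emeasure M {x \<in> space M. U x \<in> E \<and> X x \<in> B}
      = (\<integral>\<^sup>+x. indicator E (U x) * emeasure (\<kappa> (U x)) B \<partial>M)"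
    and f: "f \<in> borel_measurable N" and g: "g \<in> borel_measurable R"
  shows "(\<integral>\<^sup>+x. f (U x) * g (X x) \<partial>M) = (\<integral>\<^sup>+x. f (U x) * (\<integral>\<^sup>+o'. g o' \<partial>\<kappa> (U x)) \<partial>M)"
proof -
  have sets_k: "sets (\<kappa> (U x)) = sets R" if "x \<in> space M" for x
    using sets_kernel[OF k measurable_space[OF U that]] .
  \<comment> \<open>First induction: \<open>g\<close> varies while the weight stays an
    indicator.\<close>
  have sets_version: "(\<integral>\<^sup>+x. indicator E (U x) * g (X x) \<partial>M)
      = (\<integral>\<^sup>+x. indicator E (U x) * (\<integral>\<^sup>+o'. g o' \<partial>\<kappa> (U x)) \<partial>M)"
    if E[measurable]: "E \<in> sets N" for E
    using g
  proof (induct rule: borel_measurable_induct)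
    case (cong g h)
    have "(\<integral>\<^sup>+o'. g o' \<partial>\<kappa> (U x)) = (\<integral>\<^sup>+o'. h o' \<partial>\<kappa> (U x))" if "x \<in> space M" for x
      using cong(3) sets_eq_imp_space_eq[OF sets_k[OF that]] by (intro nn_integral_cong) simp
    moreover have "g (X x) = h (X x)" if "x \<in> space M" for x
      using cong(3) measurable_space[OF X that] by simp
    ultimately show ?case
      using cong(4) by (simp cong: nn_integral_cong)
  next
    case (set B)
    note [measurable] = set
    have "(\<integral>\<^sup>+x. indicator E (U x) * indicator B (X x) \<partial>M)
        = (\<integral>\<^sup>+x. indicator {x \<in> space M. U x \<in> E \<and> X x \<in> B} x \<partial>M)"
      by (intro nn_integral_cong) (auto simp: indicator_def)
    also have "\<dots> = emeasure M {x \<in> space M. U x \<in> E \<and> X x \<in> B}"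
      by (intro nn_integral_indicator) measurable
    also have "\<dots> = (\<integral>\<^sup>+x. indicator E (U x) * emeasure (\<kappa> (U x)) B \<partial>M)"
      by (rule rect[OF E set])
    also have "\<dots> = (\<integral>\<^sup>+x. indicator E (U x) * (\<integral>\<^sup>+o'. indicator B o' \<partial>\<kappa> (U x)) \<partial>M)"
      using set by (intro nn_integral_cong) (simp add: sets_k)
    finally show ?case .
  next
    case (mult h c)
    note [measurable] = mult(2)
    have "(\<integral>\<^sup>+x. indicator E (U x) * (c * h (X x)) \<partial>M) = c * (\<integral>\<^sup>+x. indicator E (U x) * h (X x) \<partial>M)"
      by (subst nn_integral_cmult[symmetric]) (auto simp: mult_ac)
    moreover have "(\<integral>\<^sup>+x. indicator E (U x) * (\<integral>\<^sup>+o'. c * h o' \<partial>\<kappa> (U x)) \<partial>M)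
        = (\<integral>\<^sup>+x. c * (indicator E (U x) * (\<integral>\<^sup>+o'. h o' \<partial>\<kappa> (U x))) \<partial>M)"
      by (intro nn_integral_cong) (simp add: nn_integral_cmult measurable_cong_sets[OF sets_k refl] mult(2) mult_ac)
    moreover have "\<dots> = c * (\<integral>\<^sup>+x. indicator E (U x) * (\<integral>\<^sup>+o'. h o' \<partial>\<kappa> (U x)) \<partial>M)"
      by (rule nn_integral_cmult) measurable
    ultimately show ?case
      using mult(4) by simp
  next
    case (add u v)
    note [measurable] = add(1,4)
    have "(\<integral>\<^sup>+x. indicator E (U x) * (v (X x) + u (X x)) \<partial>M)
      = (\<integral>\<^sup>+x. indicator E (U x) * v (X x) \<partial>M) + (\<integral>\<^sup>+x. indicator E (U x) * u (X x) \<partial>M)"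
      by (subst nn_integral_add[symmetric]) (auto simp: distrib_left)
    moreover have "(\<integral>\<^sup>+x. indicator E (U x) * (\<integral>\<^sup>+o'. v o' + u o' \<partial>\<kappa> (U x)) \<partial>M)
      = (\<integral>\<^sup>+x. indicator E (U x) * (\<integral>\<^sup>+o'. v o' \<partial>\<kappa> (U x)) + indicator E (U x) * (\<integral>\<^sup>+o'. u o' \<partial>\<kappa> (U x)) \<partial>M)"
      by (intro nn_integral_cong)
         (simp add: nn_integral_add measurable_cong_sets[OF sets_k refl] add(1,4) distrib_left)
    moreover have "\<dots> = (\<integral>\<^sup>+x. indicator E (U x) * (\<integral>\<^sup>+o'. v o' \<partial>\<kappa> (U x)) \<partial>M)
      + (\<integral>\<^sup>+x. indicator E (U x) * (\<integral>\<^sup>+o'. u o' \<partial>\<kappa> (U x)) \<partial>M)"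
      by (rule nn_integral_add) measurable
    ultimately show ?case
      using add(3,7) by simp
  next
    case (seq F)
    note [measurable] = seq(1)
    have "(\<integral>\<^sup>+x. indicator E (U x) * (SUP i. F i) (X x) \<partial>M)
        = (\<integral>\<^sup>+x. (SUP i. indicator E (U x) * F i (X x)) \<partial>M)"
      by (simp add: SUP_mult_left_ennreal image_comp)
    also have "\<dots> = (SUP i. \<integral>\<^sup>+x. indicator E (U x) * F i (X x) \<partial>M)"
      using seq(4) by (intro nn_integral_monotone_convergence_SUP)
        (auto simp: incseq_def le_fun_def intro!: mult_left_mono)
    also have "\<dots> = (SUP i. \<integral>\<^sup>+x. indicator E (U x) * (\<integral>\<^sup>+o'. F i o' \<partial>\<kappa> (U x)) \<partial>M)"
      by (simp add: seq(3))
    also have "\<dots> = (\<integral>\<^sup>+x. (SUP i. indicator E (U x) * (\<integral>\<^sup>+o'. F i o' \<partial>\<kappa> (U x))) \<partial>M)"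
      using seq(4) by (intro nn_integral_monotone_convergence_SUP[symmetric])
        (auto simp: incseq_def le_fun_def intro!: mult_left_mono nn_integral_mono)
    also have "\<dots> = (\<integral>\<^sup>+x. indicator E (U x) * (\<integral>\<^sup>+o'. (SUP i. F i) o' \<partial>\<kappa> (U x)) \<partial>M)"
      using seq(4) by (intro nn_integral_cong)
        (simp add: SUP_mult_left_ennreal[symmetric] image_comp measurable_cong_sets[OF sets_k refl] seq(1)
          nn_integral_monotone_convergence_SUP)
    finally show ?case .
  qed
  note [measurable] = g
  \<comment> \<open>Second induction: \<open>f\<close> varies with \<open>g\<close> fixed, and
    \<open>sets_version\<close> is its base case.\<close>
  show ?thesis
    using f
  proof (induct rule: borel_measurable_induct)
    case (cong u v)
    then show ?case
      using measurable_space[OF U] by (simp cong: nn_integral_cong)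
  next
    case (set E)
    then show ?case by (rule sets_version)
  next
    case (mult u c)
    then show ?case
      by (simp add: mult.assoc nn_integral_cmult)
  next
    case (add u v)
    then show ?case
      by (simp add: distrib_right nn_integral_add)
  next
    case (seq F)
    note [measurable] = seq(1)
    have *: "(\<integral>\<^sup>+x. (SUP i. F i) (U x) * h x \<partial>M) = (SUP i. \<integral>\<^sup>+x. F i (U x) * h x \<partial>M)"
      if [measurable]: "h \<in> borel_measurable M" for h
      using seq(4)
      by (subst nn_integral_monotone_convergence_SUP[symmetric])
        (auto simp: incseq_def le_fun_def image_comp SUP_mult_right_ennreal intro!: mult_right_mono)
    have "(\<lambda>x. g (X x)) \<in> borel_measurable M" "(\<lambda>x. \<integral>\<^sup>+o'. g o' \<partial>\<kappa> (U x)) \<in> borel_measurable M"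
      by measurable
    from this[THEN *] show ?case
      by (simp only: seq(3))
  qed
qed

text \<open>Since \<open>f\<close> is nonnegative, it is enough to split \<open>g\<close> into
  positive and negative part. The uniform bound \<open>C\<close> on the conditional absolute moment
  of \<open>g\<close>, with integrability of \<open>f\<close>, keeps both halves finite so that they
  may be subtracted. Later \<open>f\<close> is a queue length and \<open>g\<close> a one-frame
  excess.\<close>

lemma disintegrate_expectation:
  fixes f :: "'u \<Rightarrow> real" and g :: "'o \<Rightarrow> real"
  assumes U[measurable]: "U \<in> M \<rightarrow>\<^sub>M N" and X[measurable]: "X \<in> M \<rightarrow>\<^sub>M R"
    and k[measurable]: "\<kappa> \<in> N \<rightarrow>\<^sub>M subprob_algebra R"
    and rect: "\<And>E B. E \<in> sets N \<Longrightarrow> B \<in> sets R \<Longrightarrow>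
      emeasure M {x \<in> space M. U x \<in> E \<and> X x \<in> B}
      = (\<integral>\<^sup>+x. indicator E (U x) * emeasure (\<kappa> (U x)) B \<partial>M)"
    and f[measurable]: "f \<in> borel_measurable N" and g[measurable]: "g \<in> borel_measurable R"
    and f_nonneg: "\<And>u. u \<in> space N \<Longrightarrow> 0 \<le> f u"
    and f_int: "integrable M (\<lambda>x. f (U x))"
    and g_bound: "\<And>u. u \<in> space N \<Longrightarrow> (\<integral>\<^sup>+o'. ennreal \<bar>g o'\<bar> \<partial>\<kappa> u) \<le> ennreal C"
  shows "integrable M (\<lambda>x. f (U x) * g (X x))"
    and "(\<integral>x. f (U x) * g (X x) \<partial>M) = (\<integral>x. f (U x) * (\<integral>o'. g o' \<partial>\<kappa> (U x)) \<partial>M)"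
proof -
  have U_in: "U x \<in> space N" if "x \<in> space M" for x
    using measurable_space[OF U that] .
  have g_meas: "g \<in> borel_measurable (\<kappa> u)" if "u \<in> space N" for u
    using sets_kernel[OF k that] g by (simp cong: measurable_cong_sets)
  have nn: "(\<integral>\<^sup>+x. ennreal (f (U x)) * ennreal (h (X x)) \<partial>M)
      = (\<integral>\<^sup>+x. ennreal (f (U x)) * (\<integral>\<^sup>+o'. ennreal (h o') \<partial>\<kappa> (U x)) \<partial>M)"
    if "h \<in> borel_measurable R" for h :: "_ \<Rightarrow> real"
    by (intro disintegrate_nn_integral[OF U X k rect] measurable_compose[OF _ measurable_ennreal] f that)
  \<comment> \<open>Stated for every nonnegative \<open>h\<close> below
    \<open>\<bar>g\<bar>\<close>, so that it serves both halves of \<open>g\<close>.\<close>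
  have part: "integrable M (\<lambda>x. f (U x) * h (X x)) \<and>
      integrable M (\<lambda>x. f (U x) * (\<integral>o'. h o' \<partial>\<kappa> (U x))) \<and>
      (\<integral>x. f (U x) * h (X x) \<partial>M) = (\<integral>x. f (U x) * (\<integral>o'. h o' \<partial>\<kappa> (U x)) \<partial>M)"
    if h[measurable]: "h \<in> borel_measurable R" and h_nonneg: "\<And>o'. 0 \<le> h o'" and h_le: "\<And>o'. h o' \<le> \<bar>g o'\<bar>" for h :: "'o \<Rightarrow> real"
  proof -
    have h_meas: "h \<in> borel_measurable (\<kappa> u)" if "u \<in> space N" for u
      using sets_kernel[OF k that] h by (simp cong: measurable_cong_sets)
    have le_C: "(\<integral>\<^sup>+o'. ennreal (h o') \<partial>\<kappa> u) \<le> ennreal C" if "u \<in> space N" for u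
      using h_le by (intro order.trans[OF _ g_bound[OF that]] nn_integral_mono) (simp add: ennreal_leI)
    have eq: "(\<integral>\<^sup>+o'. ennreal (h o') \<partial>\<kappa> u) = ennreal (\<integral>o'. h o' \<partial>\<kappa> u)" if "u \<in> space N" for u
      using le_C[OF that] h_meas[OF that] h_nonneg
      by (intro nn_integral_eq_integral integrableI_nonneg) (auto intro: order.strict_trans1)
    have h_mean_nonneg: "0 \<le> (\<integral>o'. h o' \<partial>\<kappa> u)" for u
      using h_nonneg by simp
    have same: "(\<integral>\<^sup>+x. ennreal (f (U x) * h (X x)) \<partial>M) = (\<integral>\<^sup>+x. ennreal (f (U x) * (\<integral>o'. h o' \<partial>\<kappa> (U x))) \<partial>M)"
    proof -
      have "(\<integral>\<^sup>+x. ennreal (f (U x) * h (X x)) \<partial>M) = (\<integral>\<^sup>+x. ennreal (f (U x)) * ennreal (h (X x)) \<partial>M)"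
        by (intro nn_integral_cong) (simp add: ennreal_mult f_nonneg U_in h_nonneg)
      also have "\<dots> = (\<integral>\<^sup>+x. ennreal (f (U x)) * (\<integral>\<^sup>+o'. ennreal (h o') \<partial>\<kappa> (U x)) \<partial>M)"
        by (rule nn[OF h])
      also have "\<dots> = (\<integral>\<^sup>+x. ennreal (f (U x) * (\<integral>o'. h o' \<partial>\<kappa> (U x))) \<partial>M)"
        by (intro nn_integral_cong) (simp add: ennreal_mult f_nonneg U_in h_mean_nonneg eq)
      finally show ?thesis .
    qed
    have fin: "(\<integral>\<^sup>+x. ennreal (f (U x) * (\<integral>o'. h o' \<partial>\<kappa> (U x))) \<partial>M) < \<infinity>"
    proof -
      have "(\<integral>\<^sup>+x. ennreal (f (U x) * (\<integral>o'. h o' \<partial>\<kappa> (U x))) \<partial>M) \<le> (\<integral>\<^sup>+x. ennreal C * ennreal (f (U x)) \<partial>M)"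
        using le_C by (intro nn_integral_mono)
          (simp add: ennreal_mult f_nonneg U_in h_mean_nonneg eq[symmetric] mult.commute[of "ennreal C"] mult_left_mono)
      also have "\<dots> = ennreal C * (\<integral>\<^sup>+x. ennreal (f (U x)) \<partial>M)"
        by (rule nn_integral_cmult) measurable
      also have "\<dots> = ennreal C * ennreal (\<integral>x. f (U x) \<partial>M)"
        using f_int f_nonneg U_in by (subst nn_integral_eq_integral) auto
      also have "\<dots> < \<infinity>"
        by (simp add: ennreal_mult_less_top)
      finally show ?thesis .
    qed
    have meas: "(\<lambda>x. f (U x) * (\<integral>o'. h o' \<partial>\<kappa> (U x))) \<in> borel_measurable M"
      by (intro borel_measurable_times measurable_compose[OF U f]
          measurable_compose[OF U] measurable_compose[OF k integral_measurable_subprob_algebra[OF h]])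
    have "integrable M (\<lambda>x. f (U x) * h (X x))"
      using fin same f_nonneg U_in h_nonneg by (intro integrableI_nonneg) auto
    moreover have "integrable M (\<lambda>x. f (U x) * (\<integral>o'. h o' \<partial>\<kappa> (U x)))"
      using fin f_nonneg U_in h_mean_nonneg meas by (intro integrableI_nonneg) auto
    moreover have "(\<integral>x. f (U x) * h (X x) \<partial>M) = (\<integral>x. f (U x) * (\<integral>o'. h o' \<partial>\<kappa> (U x)) \<partial>M)"
      using same f_nonneg U_in h_nonneg h_mean_nonneg meas by (simp add: integral_eq_nn_integral)
    ultimately show ?thesis by blast
  qed
  let ?p = "\<lambda>o'. max 0 (g o')" and ?n = "\<lambda>o'. max 0 (- g o')"
  have p: "?p \<in> borel_measurable R" and n: "?n \<in> borel_measurable R"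
    by measurable
  note P = part[OF p] and N = part[OF n]
  have g_split: "g o' = ?p o' - ?n o'" for o' by auto
  have int_p: "integrable (\<kappa> u) ?p" and int_n: "integrable (\<kappa> u) ?n" if "u \<in> space N" for u
  proof -
    have "integrable (\<kappa> u) g"
      using g_bound[OF that] g_meas[OF that] by (intro integrableI_bounded) (auto intro: order.strict_trans1)
    then show "integrable (\<kappa> u) ?p" "integrable (\<kappa> u) ?n"
      by auto
  qed
  have split1: "f (U x) * g (X x) = f (U x) * ?p (X x) - f (U x) * ?n (X x)" for x
    by (subst g_split) (simp only: right_diff_distrib)
  have split2: "f (U x) * (\<integral>o'. g o' \<partial>\<kappa> (U x))
      = f (U x) * (\<integral>o'. ?p o' \<partial>\<kappa> (U x)) - f (U x) * (\<integral>o'. ?n o' \<partial>\<kappa> (U x))" if "x \<in> space M" for x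
    using int_p[OF U_in[OF that]] int_n[OF U_in[OF that]]
    by (subst g_split) (simp only: Bochner_Integration.integral_diff right_diff_distrib)
  show "integrable M (\<lambda>x. f (U x) * g (X x))"
    unfolding split1 using P N by (intro Bochner_Integration.integrable_diff) auto
  have "(\<integral>x. f (U x) * g (X x) \<partial>M) = (\<integral>x. f (U x) * ?p (X x) \<partial>M) - (\<integral>x. f (U x) * ?n (X x) \<partial>M)"
    unfolding split1 using P N by (intro Bochner_Integration.integral_diff) auto
  also have "\<dots> = (\<integral>x. f (U x) * (\<integral>o'. ?p o' \<partial>\<kappa> (U x)) \<partial>M) - (\<integral>x. f (U x) * (\<integral>o'. ?n o' \<partial>\<kappa> (U x)) \<partial>M)"
    using P N by auto
  also have "\<dots> = (\<integral>x. f (U x) * (\<integral>o'. ?p o' \<partial>\<kappa> (U x)) - f (U x) * (\<integral>o'. ?n o' \<partial>\<kappa> (U x)) \<partial>M)"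
    using P N by (intro Bochner_Integration.integral_diff[symmetric]) auto
  also have "\<dots> = (\<integral>x. f (U x) * (\<integral>o'. g o' \<partial>\<kappa> (U x)) \<partial>M)"
    by (intro Bochner_Integration.integral_cong) (auto simp: split2)
  finally show "(\<integral>x. f (U x) * g (X x) \<partial>M) = (\<integral>x. f (U x) * (\<integral>o'. g o' \<partial>\<kappa> (U x)) \<partial>M)" .
qed

text \<open>The equation \<open>indep\<close> says that \<open>W\<close> has law \<open>K\<close>
  and is independent of \<open>X\<close>, so Fubini applies on the image space. Boundedness of
  \<open>h\<close> makes the product integrable.\<close>

lemma expectation_indep_product:
  fixes f :: "'u \<Rightarrow> real" and h :: "'w \<Rightarrow> real"
  assumes M: "prob_space M" and K: "prob_space K"
    and X[measurable]: "X \<in> M \<rightarrow>\<^sub>M N" and W[measurable]: "W \<in> M \<rightarrow>\<^sub>M K"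
    and indep: "distr M (N \<Otimes>\<^sub>M K) (\<lambda>x. (X x, W x)) = distr M N X \<Otimes>\<^sub>M K"
    and f[measurable]: "f \<in> borel_measurable N" and h[measurable]: "h \<in> borel_measurable K"
    and f_int: "integrable M (\<lambda>x. f (X x))"
    and h_bound: "\<forall>w\<in>space K. \<bar>h w\<bar> \<le> C"
  shows "integrable M (\<lambda>x. f (X x) * h (W x))"
    and "(\<integral>x. f (X x) * h (W x) \<partial>M) = (\<integral>x. f (X x) \<partial>M) * (\<integral>w. h w \<partial>K)"
proof -
  interpret M: prob_space M by fact
  interpret K: prob_space K by fact
  interpret D: prob_space "distr M N X" by (rule M.prob_space_distr) fact
  interpret P: pair_prob_space "distr M N X" K ..
  show int: "integrable M (\<lambda>x. f (X x) * h (W x))"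
  proof (rule Bochner_Integration.integrable_bound)
    show "integrable M (\<lambda>x. C * f (X x))" using f_int by simp
    have "\<bar>h (W x)\<bar> \<le> \<bar>C\<bar>" if "x \<in> space M" for x
      using bspec[OF h_bound measurable_space[OF W that]] by linarith
    then show "AE x in M. norm (f (X x) * h (W x)) \<le> norm (C * f (X x))"
      by (intro AE_I2) (simp add: abs_mult mult.commute[of "\<bar>C\<bar>"] mult_left_mono)
  qed measurable
  have "integrable (distr M (N \<Otimes>\<^sub>M K) (\<lambda>x. (X x, W x))) (\<lambda>(u, w). f u * h w)"
    by (subst integrable_distr_eq) (auto intro: int)
  then have int': "integrable (distr M N X \<Otimes>\<^sub>M K) (\<lambda>(u, w). f u * h w)"
    by (simp only: indep)
  have "(\<integral>x. f (X x) * h (W x) \<partial>M) = (\<integral>(u, w). f u * h w \<partial>distr M (N \<Otimes>\<^sub>M K) (\<lambda>x. (X x, W x)))"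
    by (subst integral_distr) auto
  also have "\<dots> = (\<integral>u. (\<integral>w. f u * h w \<partial>K) \<partial>distr M N X)"
    unfolding indep using P.integral_fst'[OF int'] by simp
  also have "\<dots> = (\<integral>x. f (X x) \<partial>M) * (\<integral>w. h w \<partial>K)"
    by (simp add: integral_distr)
  finally show "(\<integral>x. f (X x) * h (W x) \<partial>M) = (\<integral>x. f (X x) \<partial>M) * (\<integral>w. h w \<partial>K)" .
qed

section \<open>Almost sure convergence and passage from squares to all indices\<close>

text \<open>The series of the \<open>f k\<close> has finite expectation, so it converges almost
  surely and its terms tend to 0.\<close>

lemma AE_tendsto_zero_of_summable_expectation:
  fixes f :: "nat \<Rightarrow> 'p \<Rightarrow> real"
  assumes int: "\<And>k. integrable M (f k)" and nonneg: "\<And>k x. 0 \<le> f k x"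
    and le: "\<And>k. (\<integral>x. f k x \<partial>M) \<le> b k" and b: "summable b"
  shows "AE x in M. (\<lambda>k. f k x) \<longlonglongrightarrow> 0"
proof -
  have [measurable]: "f k \<in> borel_measurable M" for k
    using int by blast
  have b_nonneg: "0 \<le> b k" for k
    using le[of k] nonneg by (meson Bochner_Integration.integral_nonneg order_trans)
  have "(\<integral>\<^sup>+x. (\<Sum>k. ennreal (f k x)) \<partial>M) = (\<Sum>k. \<integral>\<^sup>+x. ennreal (f k x) \<partial>M)"
    by (rule nn_integral_suminf) measurable
  also have "\<dots> \<le> (\<Sum>k. ennreal (b k))"
    using nonneg le by (intro suminf_le) (auto simp: nn_integral_eq_integral[OF int] ennreal_leI)
  also have "\<dots> < \<infinity>"
    using b b_nonneg by (simp add: ennreal_suminf_neq_top less_top[symmetric])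
  finally have "AE x in M. (\<Sum>k. ennreal (f k x)) \<noteq> \<infinity>"
    by (intro nn_integral_noteq_infinite) auto
  then show ?thesis
  proof eventually_elim
    case (elim x)
    then have "summable (\<lambda>k. f k x)"
      using nonneg by (intro summable_suminf_not_top) auto
    then show ?case by (rule summable_LIMSEQ_zero)
  qed
qed

text \<open>With \<open>k = floor_sqrt n\<close> the index \<open>n\<close> lies in the block
  starting at k^2. There \<open>q n\<close> is at most \<open>R k\<close>, and replacing the
  denominator \<open>n\<close> by the smaller k^2 only enlarges the quotient.\<close>

lemma tendsto_zero_of_square_blocks:
  fixes q R :: "nat \<Rightarrow> real"
  assumes nonneg: "\<And>n. 0 \<le> q n"
    and block: "\<And>k n. k\<^sup>2 \<le> n \<Longrightarrow> n < (Suc k)\<^sup>2 \<Longrightarrow> q n \<le> R k"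
    and R: "(\<lambda>k. R k / (real k)\<^sup>2) \<longlonglongrightarrow> 0"
  shows "(\<lambda>n. q n / real n) \<longlonglongrightarrow> 0"
proof -
  have top: "filterlim floor_sqrt at_top sequentially"
    unfolding filterlim_at_top
    by (intro allI eventually_sequentiallyI[where c = "_\<^sup>2"]) (rule le_floor_sqrtI)
  show ?thesis
  proof (rule tendsto_sandwich[OF _ _ tendsto_const filterlim_compose[OF R top]])
    show "\<forall>\<^sub>F n in sequentially. q n / real n \<le> R (floor_sqrt n) / (real (floor_sqrt n))\<^sup>2"
    proof (rule eventually_sequentiallyI[where c = 1])
      fix n :: nat assume "1 \<le> n"
      have "(real (floor_sqrt n))\<^sup>2 \<le> real n"
        using floor_sqrt_power2_le[of n] by (metis of_nat_le_iff of_nat_power)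
      moreover have "0 < (real (floor_sqrt n))\<^sup>2"
        using \<open>1 \<le> n\<close> by simp
      moreover have "q n \<le> R (floor_sqrt n)"
        by (intro block floor_sqrt_power2_le Suc_floor_sqrt_power2_gt)
      ultimately show "q n / real n \<le> R (floor_sqrt n) / (real (floor_sqrt n))\<^sup>2"
        using nonneg[of n] by (intro frac_le) auto
    qed
  qed (simp add: nonneg)
qed

section \<open>Moments from the exponential bound\<close>

text \<open>The constants come from t \<le> exp t and t^2 / 2 \<le> exp t at t = \<eta> \<bar>g
  x\<bar>. A separate dominated \<open>f\<close> is allowed because the assumption bounds a
  Euclidean norm while its coordinates are what is used.\<close>

lemma exp_moment_bounds:
  fixes f g :: "'p \<Rightarrow> real"
  assumes \<eta>: "0 < \<eta>" and B: "0 < B" and fg: "\<And>x. \<bar>f x\<bar> \<le> \<bar>g x\<bar>"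
    and g[measurable]: "g \<in> borel_measurable P"
    and bnd: "(\<integral>\<^sup>+x. ennreal (exp (\<eta> * \<bar>g x\<bar>)) \<partial>P) \<le> ennreal (B + 1)"
  shows "(\<integral>\<^sup>+x. ennreal \<bar>f x\<bar> \<partial>P) \<le> ennreal ((B + 1) / \<eta>)"
    and "(\<integral>\<^sup>+x. ennreal ((f x)\<^sup>2) \<partial>P) \<le> ennreal (2 * (B + 1) / \<eta>\<^sup>2)"
proof -
  have scaled: "(\<integral>\<^sup>+x. ennreal (h x) \<partial>P) \<le> ennreal (a * (B + 1))"
    if "0 \<le> a" "\<And>x. h x \<le> a * exp (\<eta> * \<bar>g x\<bar>)" for a and h :: "'p \<Rightarrow> real"
  proof -
    have "(\<integral>\<^sup>+x. ennreal (h x) \<partial>P) \<le> (\<integral>\<^sup>+x. ennreal a * ennreal (exp (\<eta> * \<bar>g x\<bar>)) \<partial>P)"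
      using that by (intro nn_integral_mono) (simp add: ennreal_mult[symmetric] ennreal_leI)
    also have "\<dots> = ennreal a * (\<integral>\<^sup>+x. ennreal (exp (\<eta> * \<bar>g x\<bar>)) \<partial>P)"
      by (rule nn_integral_cmult) measurable
    also have "\<dots> \<le> ennreal a * ennreal (B + 1)"
      by (intro mult_left_mono bnd) simp
    also have "\<dots> = ennreal (a * (B + 1))"
      using that B by (simp add: ennreal_mult)
    finally show ?thesis .
  qed
  have "\<bar>f x\<bar> \<le> 1 / \<eta> * exp (\<eta> * \<bar>g x\<bar>)" for x
  proof -
    have "\<eta> * \<bar>f x\<bar> \<le> \<eta> * \<bar>g x\<bar>" using fg \<eta> by simp
    also have "\<dots> \<le> exp (\<eta> * \<bar>g x\<bar>)" using exp_ge_add_one_self[of "\<eta> * \<bar>g x\<bar>"] by linarith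
    finally show ?thesis using \<eta> by (simp add: field_simps)
  qed
  then show "(\<integral>\<^sup>+x. ennreal \<bar>f x\<bar> \<partial>P) \<le> ennreal ((B + 1) / \<eta>)"
    using scaled[of "1 / \<eta>" "\<lambda>x. \<bar>f x\<bar>"] \<eta> by simp
  have "(f x)\<^sup>2 \<le> 2 / \<eta>\<^sup>2 * exp (\<eta> * \<bar>g x\<bar>)" for x
  proof -
    have "\<eta>\<^sup>2 * (f x)\<^sup>2 \<le> \<eta>\<^sup>2 * (g x)\<^sup>2"
      using fg by (intro mult_left_mono) (auto simp: abs_le_square_iff)
    also have "\<dots> = (\<eta> * \<bar>g x\<bar>)\<^sup>2" by (simp add: power_mult_distrib)
    also have "\<dots> \<le> 2 * exp (\<eta> * \<bar>g x\<bar>)"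
      using exp_lower_Taylor_quadratic[of "\<eta> * \<bar>g x\<bar>"] \<eta> by (simp add: field_simps)
         (smt (verit) mult_nonneg_nonneg abs_ge_zero)
    finally show ?thesis using \<eta> by (simp add: field_simps)
  qed
  then show "(\<integral>\<^sup>+x. ennreal ((f x)\<^sup>2) \<partial>P) \<le> ennreal (2 * (B + 1) / \<eta>\<^sup>2)"
    using scaled[of "2 / \<eta>\<^sup>2" "\<lambda>x. (f x)\<^sup>2"] by simp
qed

section \<open>Pathwise inequalities for the queues and the ratio estimate\<close>

text \<open>Causality of the queue: this is what lets it be read off the history, which stores only
  the frames before \<open>n\<close>.\<close>

lemma queue_cong:
  assumes "\<And>i. i < n \<Longrightarrow> T i = T' i" and "\<And>i. i < n \<Longrightarrow> z i = z' i"
  shows "queue c T z n = queue c T' z' n"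
  using assms by (induction n) auto

lemma queue_nonneg: "0 \<le> queue c T z n $ l"
  by (cases n) auto

lemma sum_le_queue: "(\<Sum>i<n. z i $ l) \<le> queue c T z n $ l + c $ l * (\<Sum>i<n. T i)"
  by (induction n) (auto simp: algebra_simps)

text \<open>A nonnegative queue, truncated at 0 after each update, rises by at most the absolute
  value of the increment. This controls it between consecutive squares.\<close>

lemma queue_le_add_sum:
  assumes "m \<le> n"
  shows "queue c T z n $ l \<le> queue c T z m $ l + (\<Sum>i\<in>{m..<n}. \<bar>z i $ l - c $ l * T i\<bar>)"
  using assms
proof (induction n rule: dec_induct)
  case (step n)
  then show ?case
    using queue_nonneg[of c T z n l] by auto
qed simp

text \<open>Truncation at 0 cannot increase the square; expanding the untruncated square gives the
  usual Lyapunov drift inequality.\<close>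

lemma queue_Suc_square:
  "(queue c T z (Suc n) $ l)\<^sup>2
    \<le> (queue c T z n $ l)\<^sup>2 + 2 * (queue c T z n $ l * (z n $ l - c $ l * T n)) + (z n $ l - c $ l * T n)\<^sup>2"
proof -
  have "(max s 0)\<^sup>2 \<le> s\<^sup>2" for s :: real
    by (cases "0 \<le> s") auto
  from this[of "queue c T z n $ l + z n $ l - c $ l * T n"] show ?thesis
    by (simp add: power2_eq_square algebra_simps)
qed

lemma ratio_estimate_bounds:
  assumes "0 \<le> \<theta>max"
  shows "0 \<le> ratio_estimate c V \<delta> \<theta>max y T z n" and "ratio_estimate c V \<delta> \<theta>max y T z n \<le> \<theta>max"
  using assms by (cases n; simp)+

section \<open>Means and moments of a single frame\<close>

definition excess :: "real ^ 'l::finite \<Rightarrow> 'l \<Rightarrow> 'l outcome \<Rightarrow> real" where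
  "excess c l p = snd (snd p) $ l - c $ l * fst (snd p)"

definition mean_excess :: "('q::finite, 'a, 'l::finite) renewal_system \<Rightarrow> 'l \<Rightarrow> (real ^ 'q) \<times> 'a \<Rightarrow> real" where
  "mean_excess S l v = zhat S (fst v) (snd v) $ l - bound S $ l * That S (fst v) (snd v)"

lemma excess_measurable [measurable]: "excess c l \<in> borel_measurable borel"
  unfolding excess_def by (intro borel_measurable_continuous_onI continuous_intros)

lemma outcome_component_measurable [measurable]:
  "(\<lambda>p :: 'l::finite outcome. fst p) \<in> borel_measurable borel"
  "(\<lambda>p :: 'l outcome. fst (snd p)) \<in> borel_measurable borel"
  "(\<lambda>p :: 'l outcome. snd (snd p) $ l) \<in> borel_measurable borel"
  by (intro borel_measurable_continuous_onI continuous_intros)+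

locale renewal_model =
  fixes S :: "('q::finite, 'a, 'l::finite) renewal_system"
  assumes renewal: "is_renewal_system S" and exp_type: "exponential_type S"
begin

lemma state_prob: "prob_space (state_law S)"
  using renewal by (simp add: is_renewal_system_def)

lemma outcome_law_measurable: "outcome_law S n \<in> state_law S \<Otimes>\<^sub>M actions S \<rightarrow>\<^sub>M prob_algebra borel"
  using renewal by (simp add: is_renewal_system_def)

lemma outcome_law_space:
  assumes "v \<in> space (state_law S \<Otimes>\<^sub>M actions S)"
  shows "sets (outcome_law S n v) = sets borel" and "prob_space (outcome_law S n v)"
  using measurable_space[OF outcome_law_measurable assms] by (auto simp: space_prob_algebra)

lemma outcome_law_means:
  assumes "v \<in> space (state_law S \<Otimes>\<^sub>M actions S)"
  shows "has_bochner_integral (outcome_law S n v) (\<lambda>p. fst p) (yhat S (fst v) (snd v))"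
    and "has_bochner_integral (outcome_law S n v) (\<lambda>p. fst (snd p)) (That S (fst v) (snd v))"
    and "has_bochner_integral (outcome_law S n v) (excess (bound S) l) (mean_excess S l v)"
proof -
  have *: "has_bochner_integral (outcome_law S n v) (\<lambda>(y, T, z). y) (yhat S (fst v) (snd v)) \<and>
        has_bochner_integral (outcome_law S n v) (\<lambda>(y, T, z). T) (That S (fst v) (snd v)) \<and>
        has_bochner_integral (outcome_law S n v) (\<lambda>(y, T, z). z) (zhat S (fst v) (snd v))"
    using renewal assms unfolding is_renewal_system_def by (cases v) (simp add: space_pair_measure)
  then show "has_bochner_integral (outcome_law S n v) (\<lambda>p. fst p) (yhat S (fst v) (snd v))"
    and T: "has_bochner_integral (outcome_law S n v) (\<lambda>p. fst (snd p)) (That S (fst v) (snd v))"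
    by (simp_all add: case_prod_unfold)
  from * have z: "has_bochner_integral (outcome_law S n v) (\<lambda>p. snd (snd p)) (zhat S (fst v) (snd v))"
    by (simp add: case_prod_unfold)
  have "has_bochner_integral (outcome_law S n v) (\<lambda>p. snd (snd p) $ l) (zhat S (fst v) (snd v) $ l)"
    by (rule has_bochner_integral_bounded_linear[OF bounded_linear_vec_nth z])
  then show "has_bochner_integral (outcome_law S n v) (excess (bound S) l) (mean_excess S l v)"
    unfolding excess_def mean_excess_def
    by (intro has_bochner_integral_diff has_bochner_integral_mult_right T)
qed

text \<open>\<open>That\<close> and \<open>zhat\<close> are bare functions in the record. They
  become measurable as means of a kernel; the kernel of frame 0 can stand for all, since the means
  are the same in every frame.\<close>

lemma mean_measurable:
  fixes g :: "'l outcome \<Rightarrow> real"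
  assumes "g \<in> borel_measurable borel"
    and "\<And>v. v \<in> space (state_law S \<Otimes>\<^sub>M actions S) \<Longrightarrow> has_bochner_integral (outcome_law S 0 v) g (m v)"
  shows "m \<in> borel_measurable (state_law S \<Otimes>\<^sub>M actions S)"
proof (subst measurable_cong)
  show "(\<lambda>v. \<integral>p. g p \<partial>outcome_law S 0 v) \<in> borel_measurable (state_law S \<Otimes>\<^sub>M actions S)"
    by (rule measurable_compose[OF measurable_prob_algebraD[OF outcome_law_measurable]
          integral_measurable_subprob_algebra[OF assms(1)]])
qed (metis assms(2) has_bochner_integral_integral_eq)

lemma mean_excess_measurable [measurable]: "mean_excess S l \<in> borel_measurable (state_law S \<Otimes>\<^sub>M actions S)"
  by (rule mean_measurable[OF excess_measurable outcome_law_means(3)])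

lemma That_measurable [measurable]:
  "(\<lambda>v. That S (fst v) (snd v)) \<in> borel_measurable (state_law S \<Otimes>\<^sub>M actions S)"
  by (rule mean_measurable[OF outcome_component_measurable(2) outcome_law_means(2)])

text \<open>One constant serves all frames, states, actions and resources, because the exponential
  bounds are uniform in them. The bounds on the means follow from first absolute moments, and the
  lower bound on \<open>That\<close> from integrating the almost sure bound on the frame
  length.\<close>

lemma outcome_moments:
  obtains C where "0 < C"
    and "\<And>n v. v \<in> space (state_law S \<Otimes>\<^sub>M actions S) \<Longrightarrow> AE p in outcome_law S n v. 1 \<le> fst (snd p)"
    and "\<And>v. v \<in> space (state_law S \<Otimes>\<^sub>M actions S) \<Longrightarrow> \<bar>yhat S (fst v) (snd v)\<bar> \<le> C"
    and "\<And>v. v \<in> space (state_law S \<Otimes>\<^sub>M actions S) \<Longrightarrow> 1 \<le> That S (fst v) (snd v)"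
    and "\<And>v. v \<in> space (state_law S \<Otimes>\<^sub>M actions S) \<Longrightarrow> That S (fst v) (snd v) \<le> C"
    and "\<And>v l. v \<in> space (state_law S \<Otimes>\<^sub>M actions S) \<Longrightarrow> \<bar>mean_excess S l v\<bar> \<le> C"
    and "\<And>n v l. v \<in> space (state_law S \<Otimes>\<^sub>M actions S) \<Longrightarrow>
      (\<integral>\<^sup>+p. ennreal \<bar>excess (bound S) l p\<bar> \<partial>outcome_law S n v) \<le> ennreal C"
    and "\<And>n v l. v \<in> space (state_law S \<Otimes>\<^sub>M actions S) \<Longrightarrow>
      (\<integral>\<^sup>+p. ennreal ((excess (bound S) l p)\<^sup>2) \<partial>outcome_law S n v) \<le> ennreal C"
proof -
  \<comment> \<open>This is K[n] as a function of the outcome; it dominates each coordinate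
    \<open>excess (bound S) l\<close>.\<close>
  define norm_excess where
    "norm_excess p = sqrt (\<Sum>l\<in>UNIV. (excess (bound S) l p)\<^sup>2)" for p
  obtain \<eta> B where \<eta>: "\<eta> > 0" and B: "B > 0" and
    bnds: "\<And>n v. v \<in> space (state_law S \<Otimes>\<^sub>M actions S) \<Longrightarrow>
       (AE p in outcome_law S n v. 1 \<le> fst (snd p)) \<and>
       (\<integral>\<^sup>+p. ennreal (exp (\<eta> * \<bar>fst p\<bar>)) \<partial>outcome_law S n v) \<le> ennreal (B + 1) \<and>
       (\<integral>\<^sup>+p. ennreal (exp (\<eta> * \<bar>norm_excess p\<bar>)) \<partial>outcome_law S n v) \<le> ennreal (B + 1) \<and>
       (\<integral>\<^sup>+p. ennreal (exp (\<eta> * \<bar>fst (snd p)\<bar>)) \<partial>outcome_law S n v) \<le> ennreal (B + 1)"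
  proof -
    obtain \<eta> B where "\<eta> > 0" "B > 0" and "\<forall>n. \<forall>w\<in>space (state_law S). \<forall>a\<in>space (actions S).
       (AE p in outcome_law S n (w, a). 1 \<le> fst (snd p)) \<and>
       (\<integral>\<^sup>+p. ennreal (exp (\<eta> * \<bar>fst p\<bar>)) \<partial>outcome_law S n (w, a)) \<le> ennreal (B + 1) \<and>
       (\<integral>\<^sup>+p. ennreal (exp (\<eta> * \<bar>norm_excess p\<bar>)) \<partial>outcome_law S n (w, a)) \<le> ennreal (B + 1) \<and>
       (\<integral>\<^sup>+p. ennreal (exp (\<eta> * \<bar>fst (snd p)\<bar>)) \<partial>outcome_law S n (w, a)) \<le> ennreal (B + 1)"
      using exp_type unfolding exponential_type_def Let_def norm_excess_def excess_def case_prod_unfold by blast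
    then show ?thesis
      by (intro that[of \<eta> B]) (auto simp: space_pair_measure)
  qed
  define C where "C = max ((B + 1) / \<eta>) (2 * (B + 1) / \<eta>\<^sup>2)"
  have C1: "(B + 1) / \<eta> \<le> C" and C2: "2 * (B + 1) / \<eta>\<^sup>2 \<le> C"
    by (auto simp: C_def)
  have C_pos: "0 < C"
    using C1 \<eta> B by (smt (verit) divide_pos_pos)
  have norm_excess: "\<bar>excess (bound S) l p\<bar> \<le> \<bar>norm_excess p\<bar>" for l p
    unfolding norm_excess_def
    by (rule order_trans[OF _ abs_ge_self], rule real_le_rsqrt, rule order_trans[OF _ member_le_sum[of l]]) auto
  have norm_excess_meas [measurable]: "norm_excess \<in> borel_measurable borel"
    unfolding norm_excess_def by measurable
  have mean_le: "\<bar>m\<bar> \<le> C" if "has_bochner_integral P g m" "(\<integral>\<^sup>+p. ennreal \<bar>g p\<bar> \<partial>P) \<le> ennreal C"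
    for P :: "'l outcome measure" and g m
  proof -
    have "ennreal \<bar>m\<bar> \<le> ennreal C"
      using has_bochner_integral_norm_bound[OF that(1)] that(2) by (simp add: order_trans)
    then show ?thesis using C_pos by simp
  qed
  show ?thesis
  proof (rule that[OF C_pos])
    fix n l and v assume v: "v \<in> space (state_law S \<Otimes>\<^sub>M actions S)"
    interpret P: prob_space "outcome_law S n v" by (rule outcome_law_space(2)[OF v])
    have [measurable_cong]: "sets (outcome_law S n v) = sets borel" by (rule outcome_law_space(1)[OF v])
    show T1: "AE p in outcome_law S n v. 1 \<le> fst (snd p)"
      using bnds[OF v] by blast
    have excess_moments: "(\<integral>\<^sup>+p. ennreal \<bar>excess (bound S) l p\<bar> \<partial>outcome_law S n v) \<le> ennreal ((B + 1) / \<eta>)"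
        "(\<integral>\<^sup>+p. ennreal ((excess (bound S) l p)\<^sup>2) \<partial>outcome_law S n v) \<le> ennreal (2 * (B + 1) / \<eta>\<^sup>2)"
      using bnds[OF v] by (intro exp_moment_bounds[OF \<eta> B norm_excess]; measurable)+
    show ex1: "(\<integral>\<^sup>+p. ennreal \<bar>excess (bound S) l p\<bar> \<partial>outcome_law S n v) \<le> ennreal C"
      using excess_moments(1) ennreal_leI[OF C1] by (rule order_trans)
    show "(\<integral>\<^sup>+p. ennreal ((excess (bound S) l p)\<^sup>2) \<partial>outcome_law S n v) \<le> ennreal C"
      using excess_moments(2) ennreal_leI[OF C2] by (rule order_trans)
    show "\<bar>mean_excess S l v\<bar> \<le> C"
      by (rule mean_le[OF outcome_law_means(3)[OF v] ex1])
    have "(\<integral>\<^sup>+p. ennreal \<bar>fst p\<bar> \<partial>outcome_law S n v) \<le> ennreal ((B + 1) / \<eta>)"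
      using bnds[OF v] by (intro exp_moment_bounds[OF \<eta> B order_refl]; measurable)
    then show "\<bar>yhat S (fst v) (snd v)\<bar> \<le> C"
      by (intro mean_le[OF outcome_law_means(1)[OF v]] order_trans[OF _ ennreal_leI[OF C1]])
    have "(\<integral>\<^sup>+p. ennreal \<bar>fst (snd p)\<bar> \<partial>outcome_law S n v) \<le> ennreal ((B + 1) / \<eta>)"
      using bnds[OF v] by (intro exp_moment_bounds[OF \<eta> B order_refl]; measurable)
    then have "\<bar>That S (fst v) (snd v)\<bar> \<le> C"
      by (intro mean_le[OF outcome_law_means(2)[OF v]] order_trans[OF _ ennreal_leI[OF C1]])
    then show "That S (fst v) (snd v) \<le> C"
      by linarith
    have "P.expectation (\<lambda>p. 1) \<le> P.expectation (\<lambda>p. fst (snd p))"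
      using outcome_law_means(2)[OF v] T1 by (intro integral_mono_AE) (auto simp: has_bochner_integral_iff)
    then show "1 \<le> That S (fst v) (snd v)"
      using outcome_law_means(2)[OF v] by (simp add: has_bochner_integral_iff P.prob_space)
  qed
qed

end

section \<open>Queues and increments along a run of the system\<close>

locale renewal_run = renewal_model S
  for S :: "('q::finite, 'a, 'l::finite) renewal_system" +
  fixes M :: "'p measure"
    and \<omega> :: "nat \<Rightarrow> 'p \<Rightarrow> real ^ 'q"
    and \<alpha> :: "nat \<Rightarrow> 'p \<Rightarrow> 'a"
    and y T :: "nat \<Rightarrow> 'p \<Rightarrow> real"
    and z :: "nat \<Rightarrow> 'p \<Rightarrow> real ^ 'l"
  assumes run: "system_run S M \<omega> \<alpha> y T z"
begin

definition Q :: "nat \<Rightarrow> 'l \<Rightarrow> 'p \<Rightarrow> real" where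
  "Q n l x = queue (bound S) (\<lambda>i. T i x) (\<lambda>i. z i x) n $ l"

definition X :: "nat \<Rightarrow> 'l \<Rightarrow> 'p \<Rightarrow> real" where
  "X n l x = z n x $ l - bound S $ l * T n x"

text \<open>The queue once more, but on the history space: the conditional law and the independence
  are stated for histories, so a queue must be a measurable function of the history before they
  apply to it.\<close>

definition history_queue :: "nat \<Rightarrow> 'l \<Rightarrow> (nat \<Rightarrow> ('q, 'a, 'l) frame) \<Rightarrow> real" where
  "history_queue n l f = queue (bound S) (\<lambda>i. fst (snd (snd (snd (f i))))) (\<lambda>i. snd (snd (snd (snd (f i))))) n $ l"

text \<open>All that is known just before the outcome of frame \<open>n\<close>; it plays the role
  of \<open>U\<close> in the disintegration lemmas.\<close>

definition decision :: "nat \<Rightarrow> 'p \<Rightarrow> (nat \<Rightarrow> ('q, 'a, 'l) frame) \<times> (real ^ 'q) \<times> 'a" where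
  "decision n x = (history \<omega> \<alpha> y T z n x, \<omega> n x, \<alpha> n x)"

lemma M_prob: "prob_space M"
  using run by (simp add: system_run_def)

lemma frame_measurable [measurable]:
  "\<omega> n \<in> M \<rightarrow>\<^sub>M state_law S" "\<alpha> n \<in> M \<rightarrow>\<^sub>M actions S"
  "y n \<in> borel_measurable M" "T n \<in> borel_measurable M" "z n \<in> borel_measurable M"
  using run by (auto simp: system_run_def)

lemma history_measurable [measurable]: "history \<omega> \<alpha> y T z n \<in> M \<rightarrow>\<^sub>M history_space S n"
  unfolding history_def history_space_def by measurable

lemma decision_measurable [measurable]:
  "decision n \<in> M \<rightarrow>\<^sub>M history_space S n \<Otimes>\<^sub>M (state_law S \<Otimes>\<^sub>M actions S)"
  unfolding decision_def by measurable

lemma outcome_measurable [measurable]: "(\<lambda>x. (y n x, T n x, z n x)) \<in> borel_measurable M"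
  by measurable

lemma state_action_in_space:
  "x \<in> space M \<Longrightarrow> (\<omega> n x, \<alpha> n x) \<in> space (state_law S \<Otimes>\<^sub>M actions S)"
  using measurable_space[OF frame_measurable(1)] measurable_space[OF frame_measurable(2)]
  by (simp add: space_pair_measure)

lemma history_queue_measurable [measurable]:
  "history_queue n l \<in> borel_measurable (history_space S n)"
proof -
  have comp: "(\<lambda>f. g (snd (snd (f i)))) \<in> borel_measurable (history_space S n)"
    if "i < n" "g \<in> borel_measurable borel" for i and g :: "'l outcome \<Rightarrow> real"
    unfolding history_space_def
    by (rule measurable_compose[OF measurable_component_singleton[of i]],
        use that in simp, intro measurable_compose[OF measurable_compose[OF measurable_snd measurable_snd]] that)
  \<comment> \<open>The history space itself depends on \<open>n\<close>, so the induction runs over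
    \<open>k \<le> n\<close> inside one fixed product space, where coordinates below
    \<open>n\<close> are measurable.\<close>
  have "(\<lambda>f. history_queue k l f) \<in> borel_measurable (history_space S n)" if "k \<le> n" for k
    using that
  proof (induction k arbitrary: l)
    case (Suc k)
    have "history_queue (Suc k) l f
        = max (history_queue k l f + snd (snd (snd (snd (f k)))) $ l - bound S $ l * fst (snd (snd (snd (f k))))) 0" for f
      by (simp add: history_queue_def)
    then show ?case
      using Suc by (auto intro!: borel_measurable_max borel_measurable_diff borel_measurable_add
          borel_measurable_times comp[of k "\<lambda>p. snd (snd p) $ l"] comp[of k "\<lambda>p. fst (snd p)"])
  qed (simp add: history_queue_def[abs_def])
  then show ?thesis by simp
qed

lemma Q_history: "Q n l x = history_queue n l (history \<omega> \<alpha> y T z n x)"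
  unfolding Q_def history_queue_def
  by (intro arg_cong[where f = "\<lambda>q. q $ l"] queue_cong) (auto simp: history_def)

lemma Q_measurable [measurable]: "Q n l \<in> borel_measurable M"
  unfolding Q_history by measurable

lemma X_excess: "X n l x = excess (bound S) l (y n x, T n x, z n x)"
  by (simp add: X_def excess_def)

lemma X_measurable [measurable]: "X n l \<in> borel_measurable M"
  unfolding X_excess[abs_def] by measurable

lemma Q_nonneg: "0 \<le> Q n l x"
  by (simp add: Q_def queue_nonneg)

lemma Q_Suc_square: "(Q (Suc n) l x)\<^sup>2 \<le> (Q n l x)\<^sup>2 + 2 * (Q n l x * X n l x) + (X n l x)\<^sup>2"
  unfolding Q_def X_def by (rule queue_Suc_square)

lemma kernel_measurable:
  "(\<lambda>u. outcome_law S n (snd u)) \<in> history_space S n \<Otimes>\<^sub>M (state_law S \<Otimes>\<^sub>M actions S) \<rightarrow>\<^sub>M subprob_algebra borel"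
  by (rule measurable_compose[OF measurable_snd measurable_prob_algebraD[OF outcome_law_measurable]])

lemma outcome_conditional_law:
  assumes "E \<in> sets (history_space S n \<Otimes>\<^sub>M (state_law S \<Otimes>\<^sub>M actions S))" and "B \<in> sets borel"
  shows "emeasure M {x \<in> space M. decision n x \<in> E \<and> (y n x, T n x, z n x) \<in> B}
    = (\<integral>\<^sup>+x. indicator E (decision n x) * emeasure (outcome_law S n (snd (decision n x))) B \<partial>M)"
  using run assms unfolding system_run_def decision_def by simp

text \<open>The conditional law gives measure 0 to outcomes with frame length below 1. The rectangle
  identity with the whole space in the first factor transfers this to \<open>M\<close>.\<close>

lemma AE_frame_length: "AE x in M. 1 \<le> T n x"
proof -
  obtain C where T1: "\<And>v. v \<in> space (state_law S \<Otimes>\<^sub>M actions S) \<Longrightarrow> AE p in outcome_law S n v. 1 \<le> fst (snd p)"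
    by (rule outcome_moments) blast
  let ?B = "{p :: 'l outcome. \<not> 1 \<le> fst (snd p)}"
  have B: "?B \<in> sets borel"
  proof -
    have "{p \<in> space borel. \<not> 1 \<le> fst (snd (p :: 'l outcome))} \<in> sets borel"
      by measurable
    then show ?thesis by simp
  qed
  have null: "emeasure (outcome_law S n (\<omega> n x, \<alpha> n x)) ?B = 0" if "x \<in> space M" for x
  proof -
    note v = state_action_in_space[OF that]
    have "space (outcome_law S n (\<omega> n x, \<alpha> n x)) = UNIV"
      using sets_eq_imp_space_eq[OF outcome_law_space(1)[OF v]] by simp
    then show ?thesis
      using T1[OF v, of n] B outcome_law_space(1)[OF v, of n]
        AE_iff_measurable[of ?B "outcome_law S n (\<omega> n x, \<alpha> n x)" "\<lambda>p. 1 \<le> fst (snd p)"] by simp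
  qed
  have "emeasure M {x \<in> space M. \<not> 1 \<le> T n x}
      = (\<integral>\<^sup>+x. indicator (space (history_space S n \<Otimes>\<^sub>M (state_law S \<Otimes>\<^sub>M actions S))) (decision n x)
          * emeasure (outcome_law S n (snd (decision n x))) ?B \<partial>M)"
    using measurable_space[OF decision_measurable]
    by (subst outcome_conditional_law[OF sets.top B, symmetric]) (auto intro!: arg_cong[where f = "emeasure M"])
  also have "\<dots> = (\<integral>\<^sup>+x. 0 \<partial>M)"
    by (intro nn_integral_cong) (simp add: decision_def null)
  finally show ?thesis
    by (subst AE_iff_measurable[OF _ refl]) auto
qed

lemma X_second_moment:
  obtains C where "0 < C" and "\<And>n l. integrable M (\<lambda>x. (X n l x)\<^sup>2)"
    and "\<And>n l. (\<integral>x. (X n l x)\<^sup>2 \<partial>M) \<le> C"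
proof -
  obtain C where C: "0 < C" and bnd: "\<And>n v l. v \<in> space (state_law S \<Otimes>\<^sub>M actions S) \<Longrightarrow>
      (\<integral>\<^sup>+p. ennreal ((excess (bound S) l p)\<^sup>2) \<partial>outcome_law S n v) \<le> ennreal C"
    by (rule outcome_moments) blast
  interpret M: prob_space M by (rule M_prob)
  have le: "(\<integral>\<^sup>+x. ennreal ((X n l x)\<^sup>2) \<partial>M) \<le> ennreal C" for n l
  proof -
    have meas: "(\<lambda>p. ennreal ((excess (bound S) l p)\<^sup>2)) \<in> borel_measurable borel"
      by measurable
    have "(\<integral>\<^sup>+x. ennreal ((X n l x)\<^sup>2) \<partial>M)
        = (\<integral>\<^sup>+x. 1 * ennreal ((excess (bound S) l (y n x, T n x, z n x))\<^sup>2) \<partial>M)"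
      by (simp add: X_excess)
    also have "\<dots> = (\<integral>\<^sup>+x. 1 * (\<integral>\<^sup>+p. ennreal ((excess (bound S) l p)\<^sup>2) \<partial>outcome_law S n (snd (decision n x))) \<partial>M)"
      by (rule disintegrate_nn_integral[OF decision_measurable outcome_measurable kernel_measurable
            outcome_conditional_law borel_measurable_const meas])
    also have "\<dots> \<le> (\<integral>\<^sup>+x. ennreal C \<partial>M)"
      using state_action_in_space by (intro nn_integral_mono) (auto simp: decision_def bnd)
    also have "\<dots> = ennreal C"
      by (simp add: M.emeasure_space_1)
    finally show ?thesis .
  qed
  have int: "integrable M (\<lambda>x. (X n l x)\<^sup>2)" for n l
    using le[of n l] by (intro integrableI_nonneg) (auto intro: order.strict_trans1)
  have "(\<integral>x. (X n l x)\<^sup>2 \<partial>M) \<le> C" for n l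
    using le[of n l] C by (subst (asm) nn_integral_eq_integral[OF int]) auto
  then show ?thesis
    using that C int by blast
qed

text \<open>Finiteness has to precede any quantitative bound, since the drift inequality can only be
  integrated term by term once each term is integrable. The crude estimate 2ab \<le> a^2 + b^2 for
  the cross term suffices, although it may double the bound in every frame.\<close>

lemma integrable_Q_square: "integrable M (\<lambda>x. (Q n l x)\<^sup>2)"
proof (induction n)
  case 0
  show ?case by (simp add: Q_def)
next
  case (Suc n)
  have X2: "integrable M (\<lambda>x. (X n l x)\<^sup>2)"
    by (rule X_second_moment) blast
  have "(Q (Suc n) l x)\<^sup>2 \<le> 2 * (Q n l x)\<^sup>2 + 2 * (X n l x)\<^sup>2" for x
    using Q_Suc_square[of n l x] sum_squares_bound[of "Q n l x" "X n l x"] by simp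
  then show ?case
    using Suc X2
    by (intro Bochner_Integration.integrable_bound[where g = "\<lambda>x. (Q (Suc n) l x)\<^sup>2"
        and f = "\<lambda>x. 2 * (Q n l x)\<^sup>2 + 2 * (X n l x)\<^sup>2"]) auto
qed

lemma integrable_Q: "integrable M (Q n l)"
proof -
  interpret M: prob_space M by (rule M_prob)
  show ?thesis
    by (rule M.square_integrable_imp_integrable[OF Q_measurable integrable_Q_square])
qed

text \<open>The queue is fixed by the history, so conditioning on the decision acts only on the
  increment and turns it into its mean at the chosen pair.\<close>

lemma expectation_Q_X:
  shows "integrable M (\<lambda>x. Q n l x * X n l x)"
    and "(\<integral>x. Q n l x * X n l x \<partial>M) = (\<integral>x. Q n l x * mean_excess S l (\<omega> n x, \<alpha> n x) \<partial>M)"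
proof -
  obtain C where bnd: "\<And>n v l. v \<in> space (state_law S \<Otimes>\<^sub>M actions S) \<Longrightarrow>
      (\<integral>\<^sup>+p. ennreal \<bar>excess (bound S) l p\<bar> \<partial>outcome_law S n v) \<le> ennreal C"
    by (rule outcome_moments) blast
  have meas: "(\<lambda>u. history_queue n l (fst u)) \<in> borel_measurable (history_space S n \<Otimes>\<^sub>M (state_law S \<Otimes>\<^sub>M actions S))"
    by measurable
  have nonneg: "0 \<le> history_queue n l (fst u)" for u :: "(nat \<Rightarrow> ('q, 'a, 'l) frame) \<times> (real ^ 'q) \<times> 'a"
    by (simp add: history_queue_def queue_nonneg)
  have Q_decision: "history_queue n l (fst (decision n x)) = Q n l x" for x
    by (simp add: decision_def Q_history)
  have int: "integrable M (\<lambda>x. history_queue n l (fst (decision n x)))"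
    unfolding Q_decision by (rule integrable_Q)
  have "(\<integral>\<^sup>+p. ennreal \<bar>excess (bound S) l p\<bar> \<partial>outcome_law S n (snd u)) \<le> ennreal C"
    if "u \<in> space (history_space S n \<Otimes>\<^sub>M (state_law S \<Otimes>\<^sub>M actions S))" for u
    using that by (intro bnd) (auto simp: space_pair_measure)
  note dis = disintegrate_expectation[OF decision_measurable outcome_measurable kernel_measurable
      outcome_conditional_law meas excess_measurable nonneg int this, unfolded Q_decision X_excess[symmetric]]
  show "integrable M (\<lambda>x. Q n l x * X n l x)"
    by (rule dis(1))
  have "(\<integral>p. excess (bound S) l p \<partial>outcome_law S n (snd (decision n x))) = mean_excess S l (\<omega> n x, \<alpha> n x)"
    if "x \<in> space M" for x
    using outcome_law_means(3)[OF state_action_in_space[OF that]]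
    by (simp add: decision_def has_bochner_integral_iff)
  then show "(\<integral>x. Q n l x * X n l x \<partial>M) = (\<integral>x. Q n l x * mean_excess S l (\<omega> n x, \<alpha> n x) \<partial>M)"
    by (intro trans[OF dis(2)] Bochner_Integration.integral_cong) auto
qed

end

section \<open>Averages over stationary policies\<close>

lemma policy_space:
  assumes "stationary_policy S \<pi>" and "w \<in> space (state_law S)"
  shows "prob_space (\<pi> w)" and "space (\<pi> w) = space (actions S)" and "sets (\<pi> w) = sets (actions S)"
  using measurable_space[OF assms(1)[unfolded stationary_policy_def] assms(2)]
  by (auto simp: space_prob_algebra dest: sets_eq_imp_space_eq)

lemma (in renewal_model) policy_average:
  fixes g :: "(real ^ 'q) \<times> 'a \<Rightarrow> real"
  assumes pol: "stationary_policy S \<pi>"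
    and g[measurable]: "g \<in> borel_measurable (state_law S \<Otimes>\<^sub>M actions S)"
    and bnd: "\<forall>v\<in>space (state_law S \<Otimes>\<^sub>M actions S). \<bar>g v\<bar> \<le> C"
  shows "\<And>w. w \<in> space (state_law S) \<Longrightarrow> integrable (\<pi> w) (\<lambda>a. g (w, a))"
    and "(\<lambda>w. \<integral>a. g (w, a) \<partial>\<pi> w) \<in> borel_measurable (state_law S)"
    and "\<And>w. w \<in> space (state_law S) \<Longrightarrow> \<bar>\<integral>a. g (w, a) \<partial>\<pi> w\<bar> \<le> C"
proof -
  have pi_meas: "\<pi> \<in> state_law S \<rightarrow>\<^sub>M subprob_algebra (actions S)"
    using pol unfolding stationary_policy_def by (rule measurable_prob_algebraD)
  have g_section: "(\<lambda>a. g (w, a)) \<in> borel_measurable (\<pi> w)" if w: "w \<in> space (state_law S)" for w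
    using measurable_Pair2[OF g w] policy_space(3)[OF pol w] by (simp cong: measurable_cong_sets)
  show int: "integrable (\<pi> w) (\<lambda>a. g (w, a))" if w: "w \<in> space (state_law S)" for w
  proof -
    interpret A: prob_space "\<pi> w" using policy_space(1)[OF pol w] .
    show ?thesis
      using bnd w policy_space(2)[OF pol w] g_section[OF w]
      by (intro A.integrable_const_bound[where B = C]) (auto simp: space_pair_measure)
  qed
  show "\<bar>\<integral>a. g (w, a) \<partial>\<pi> w\<bar> \<le> C" if w: "w \<in> space (state_law S)" for w
  proof -
    interpret A: prob_space "\<pi> w" using policy_space(1)[OF pol w] .
    have "\<bar>\<integral>a. g (w, a) \<partial>\<pi> w\<bar> \<le> A.expectation (\<lambda>a. \<bar>g (w, a)\<bar>)"
      by (rule integral_abs_bound)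
    also have "\<dots> \<le> A.expectation (\<lambda>a. C)"
      using bnd w policy_space(2)[OF pol w] int[OF w] by (intro integral_mono) (auto simp: space_pair_measure)
    finally show ?thesis by (simp add: A.prob_space)
  qed
  \<comment> \<open>The integrand \<open>g (w, a)\<close> and the measure \<open>\<pi> w\<close>
    both vary with \<open>w\<close>. Pushing \<open>\<pi> w\<close> forward along
    \<open>Pair w\<close> leaves a fixed integrand \<open>g\<close> against a kernel, whose integral
    is measurable in \<open>w\<close>.\<close>
  have "(\<lambda>w. \<integral>v. g v \<partial>distr (\<pi> w) (state_law S \<Otimes>\<^sub>M actions S) (Pair w)) \<in> borel_measurable (state_law S)"
    by (rule measurable_compose[OF measurable_distr2[OF _ pi_meas] integral_measurable_subprob_algebra[OF g]])
       measurable
  moreover have "(\<integral>v. g v \<partial>distr (\<pi> w) (state_law S \<Otimes>\<^sub>M actions S) (Pair w)) = (\<integral>a. g (w, a) \<partial>\<pi> w)"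
    if w: "w \<in> space (state_law S)" for w
    using measurable_Pair1'[OF w, of "actions S"] policy_space(3)[OF pol w] g
    by (subst integral_distr) (auto cong: measurable_cong_sets)
  ultimately show "(\<lambda>w. \<integral>a. g (w, a) \<partial>\<pi> w) \<in> borel_measurable (state_law S)"
    by (simp cong: measurable_cong)
qed

text \<open>
  Slackness serves only as a policy whose resource use is at most the allowed one, so that by
  independence of the current state from the queues its expected drift is nonpositive.
\<close>

lemma (in renewal_model) slack_policy:
  assumes "xi_slackness S"
  obtains \<pi> where "stationary_policy S \<pi>"
    and "\<And>l. (\<integral>w. (\<integral>a. mean_excess S l (w, a) \<partial>\<pi> w) \<partial>state_law S) \<le> 0"
proof -
  obtain \<xi> \<pi> where \<xi>: "0 < \<xi>" and pol: "stationary_policy S \<pi>" and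
    slack: "\<And>l. one_shot_average S \<pi> (\<lambda>w a. zhat S w a $ l) / one_shot_average S \<pi> (That S) = bound S $ l - \<xi>"
    using assms by (auto simp: xi_slackness_def)
  obtain C where T1: "\<And>v. v \<in> space (state_law S \<Otimes>\<^sub>M actions S) \<Longrightarrow> 1 \<le> That S (fst v) (snd v)"
    and TC: "\<And>v. v \<in> space (state_law S \<Otimes>\<^sub>M actions S) \<Longrightarrow> That S (fst v) (snd v) \<le> C"
    and dC: "\<And>v l. v \<in> space (state_law S \<Otimes>\<^sub>M actions S) \<Longrightarrow> \<bar>mean_excess S l v\<bar> \<le> C"
    by (rule outcome_moments) blast
  interpret W: prob_space "state_law S" by (rule state_prob)
  define D where "D l w = (\<integral>a. mean_excess S l (w, a) \<partial>\<pi> w)" for l w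
  define t where "t w = (\<integral>a. That S w a \<partial>\<pi> w)" for w
  have "\<forall>v\<in>space (state_law S \<Otimes>\<^sub>M actions S). \<bar>That S (fst v) (snd v)\<bar> \<le> C"
    using T1 TC by (auto simp: abs_le_iff) (smt (verit))
  note T_avg = policy_average[OF pol That_measurable this, simplified, folded t_def]
  have "\<forall>v\<in>space (state_law S \<Otimes>\<^sub>M actions S). \<bar>mean_excess S l v\<bar> \<le> C" for l
    using dC by blast
  note D_avg = policy_average[OF pol mean_excess_measurable this, folded D_def]
  have t_int: "integrable (state_law S) t"
    using T_avg by (intro W.integrable_const_bound[where B = C]) auto
  have D_int: "integrable (state_law S) (D l)" for l
    using D_avg by (intro W.integrable_const_bound[where B = C]) auto
  have t1: "1 \<le> t w" if w: "w \<in> space (state_law S)" for w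
  proof -
    interpret A: prob_space "\<pi> w" using policy_space(1)[OF pol w] .
    have "A.expectation (\<lambda>a. 1) \<le> t w"
      unfolding t_def using T1 T_avg(1)[OF w] policy_space(2)[OF pol w] w
      by (intro integral_mono) (auto simp: space_pair_measure)
    then show ?thesis by (simp add: A.prob_space)
  qed
  \<comment> \<open>The denominator of the slackness ratio is at least 1. Hence the ratio can be
    multiplied out, and the mean excess becomes \<open>- \<xi>\<close> times the mean frame
    length.\<close>
  have "W.expectation (\<lambda>w. 1) \<le> W.expectation t"
    using t_int t1 by (intro integral_mono) auto
  then have t_pos: "1 \<le> W.expectation t"
    by (simp add: W.prob_space)
  have "(\<integral>w. D l w \<partial>state_law S) \<le> 0" for l
  proof -
    have "(\<integral>a. zhat S w a $ l \<partial>\<pi> w) = D l w + bound S $ l * t w" if w: "w \<in> space (state_law S)" for w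
    proof -
      have "(\<integral>a. zhat S w a $ l \<partial>\<pi> w) = (\<integral>a. mean_excess S l (w, a) + bound S $ l * That S w a \<partial>\<pi> w)"
        by (simp add: mean_excess_def)
      then show ?thesis
        using D_avg(1)[OF w] T_avg(1)[OF w] by (simp add: D_def t_def)
    qed
    then have "one_shot_average S \<pi> (\<lambda>w a. zhat S w a $ l)
        = (\<integral>w. D l w + bound S $ l * t w \<partial>state_law S)"
      unfolding one_shot_average_def by (intro Bochner_Integration.integral_cong) auto
    also have "\<dots> = W.expectation (D l) + bound S $ l * W.expectation t"
      using D_int t_int by simp
    finally have "(W.expectation (D l) + bound S $ l * W.expectation t) / W.expectation t = bound S $ l - \<xi>"
      using slack[of l] by (simp add: one_shot_average_def t_def[abs_def])
    then have "W.expectation (D l) = - \<xi> * W.expectation t"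
      using t_pos by (simp add: field_simps)
    then show ?thesis
      using \<xi> t_pos by simp
  qed
  then show ?thesis
    using that[OF pol] by (simp add: D_def)
qed

section \<open>Drift and second moments of the queues under the algorithm\<close>

locale algorithm_run = renewal_run S M \<omega> \<alpha> y T z
  for S :: "('q::finite, 'a, 'l::finite) renewal_system" and M :: "'p measure"
    and \<omega> :: "nat \<Rightarrow> 'p \<Rightarrow> real ^ 'q" and \<alpha> :: "nat \<Rightarrow> 'p \<Rightarrow> 'a"
    and y T :: "nat \<Rightarrow> 'p \<Rightarrow> real" and z :: "nat \<Rightarrow> 'p \<Rightarrow> real ^ 'l" +
  fixes V \<delta> \<theta>max :: real
  assumes V_pos: "0 < V" and \<theta>max_pos: "0 < \<theta>max" and slackness: "xi_slackness S"
    and algorithm: "follows_algorithm S V \<delta> \<theta>max M \<omega> \<alpha> y T z"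
begin

text \<open>
  The penalty part of the minimised expression is bounded on both sides, so minimality compares
  the queue drifts alone, up to a constant.
\<close>

lemma drift_le_any_action:
  obtains C where "AE x in M. \<forall>n. \<forall>a\<in>space (actions S).
    (\<Sum>l\<in>UNIV. Q n l x * mean_excess S l (\<omega> n x, \<alpha> n x)) \<le> C + (\<Sum>l\<in>UNIV. Q n l x * mean_excess S l (\<omega> n x, a))"
proof -
  obtain C where C: "0 < C"
    and yC: "\<And>v. v \<in> space (state_law S \<Otimes>\<^sub>M actions S) \<Longrightarrow> \<bar>yhat S (fst v) (snd v)\<bar> \<le> C"
    and T1: "\<And>v. v \<in> space (state_law S \<Otimes>\<^sub>M actions S) \<Longrightarrow> 1 \<le> That S (fst v) (snd v)"
    and TC: "\<And>v. v \<in> space (state_law S \<Otimes>\<^sub>M actions S) \<Longrightarrow> That S (fst v) (snd v) \<le> C"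
    by (rule outcome_moments) blast
  \<comment> \<open>\<open>C\<close> bounds the mean penalty, and \<open>\<theta>max * C\<close>
    bounds the estimate times the mean frame length. The final constant \<open>2 * V * C'\<close>
    pays for this term once at the chosen and once at the competing action.\<close>
  define C' where "C' = C + \<theta>max * C"
  have penalty: "\<bar>yhat S w a - \<theta> * That S w a\<bar> \<le> C'"
    if "0 \<le> \<theta>" "\<theta> \<le> \<theta>max" "(w, a) \<in> space (state_law S \<Otimes>\<^sub>M actions S)" for \<theta> w a
  proof -
    have "0 \<le> \<theta> * That S w a" "\<theta> * That S w a \<le> \<theta>max * C"
      using that T1[OF that(3)] TC[OF that(3)] by (auto intro!: mult_mono)
    then show ?thesis
      using yC[OF that(3)] by (simp add: C'_def)
  qed
  have "AE x in M. \<forall>n. \<forall>a\<in>space (actions S).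
    (\<Sum>l\<in>UNIV. Q n l x * mean_excess S l (\<omega> n x, \<alpha> n x))
      \<le> 2 * V * C' + (\<Sum>l\<in>UNIV. Q n l x * mean_excess S l (\<omega> n x, a))"
    using algorithm[unfolded follows_algorithm_def] AE_space
  proof eventually_elim
    case (elim x)
    show ?case
    proof (intro allI ballI)
      fix n a assume a: "a \<in> space (actions S)"
      define \<theta> where "\<theta> = ratio_estimate (bound S) V \<delta> \<theta>max (\<lambda>i. y i x) (\<lambda>i. T i x) (\<lambda>i. z i x) n"
      have \<theta>: "0 \<le> \<theta>" "\<theta> \<le> \<theta>max"
        using \<theta>max_pos by (auto simp: \<theta>_def intro!: ratio_estimate_bounds)
      note v = state_action_in_space[OF elim(2), of n]
      have v': "(\<omega> n x, a) \<in> space (state_law S \<Otimes>\<^sub>M actions S)"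
        using v a by (simp add: space_pair_measure)
      let ?G = "\<lambda>a. V * (yhat S (\<omega> n x) a - \<theta> * That S (\<omega> n x) a)
        + (\<Sum>l\<in>UNIV. Q n l x * mean_excess S l (\<omega> n x, a))"
      have "is_arg_min ?G (\<lambda>a. a \<in> space (actions S)) (\<alpha> n x)"
        using elim(1) by (simp add: Let_def \<theta>_def Q_def mean_excess_def)
      then have "?G (\<alpha> n x) \<le> ?G a"
        using a by (auto simp: is_arg_min_linorder)
      moreover have "\<bar>V * (yhat S (\<omega> n x) b - \<theta> * That S (\<omega> n x) b)\<bar> \<le> V * C'"
        if "(\<omega> n x, b) \<in> space (state_law S \<Otimes>\<^sub>M actions S)" for b
        using penalty[OF \<theta> that] V_pos by (simp add: abs_mult)
      from this[OF v] this[OF v'] have "V * (yhat S (\<omega> n x) a - \<theta> * That S (\<omega> n x) a)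
          - V * (yhat S (\<omega> n x) (\<alpha> n x) - \<theta> * That S (\<omega> n x) (\<alpha> n x)) \<le> 2 * V * C'"
        by linarith
      ultimately show "(\<Sum>l\<in>UNIV. Q n l x * mean_excess S l (\<omega> n x, \<alpha> n x))
          \<le> 2 * V * C' + (\<Sum>l\<in>UNIV. Q n l x * mean_excess S l (\<omega> n x, a))"
        by linarith
    qed
  qed
  then show ?thesis by (rule that)
qed

text \<open>Almost surely the comparison holds for every action at once, so it may be averaged over
  \<open>\<pi> (\<omega> n x)\<close>. The right side then involves the queues and a function
  \<open>D l\<close> of the current state. By independence its expectation splits into a nonnegative
  mean queue times a nonpositive mean drift, and only the constant survives.\<close>

lemma expected_drift_bounded:
  obtains C where "\<And>n. (\<Sum>l\<in>UNIV. \<integral>x. Q n l x * X n l x \<partial>M) \<le> C"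
proof -
  obtain C1 where drift: "AE x in M. \<forall>n. \<forall>a\<in>space (actions S).
    (\<Sum>l\<in>UNIV. Q n l x * mean_excess S l (\<omega> n x, \<alpha> n x)) \<le> C1 + (\<Sum>l\<in>UNIV. Q n l x * mean_excess S l (\<omega> n x, a))"
    by (rule drift_le_any_action)
  obtain \<pi> where pol: "stationary_policy S \<pi>"
    and slack: "\<And>l. (\<integral>w. (\<integral>a. mean_excess S l (w, a) \<partial>\<pi> w) \<partial>state_law S) \<le> 0"
    by (rule slack_policy[OF slackness]) blast
  obtain C where dC: "\<And>v l. v \<in> space (state_law S \<Otimes>\<^sub>M actions S) \<Longrightarrow> \<bar>mean_excess S l v\<bar> \<le> C"
    by (rule outcome_moments) blast
  interpret M: prob_space M by (rule M_prob)
  define D where "D l w = (\<integral>a. mean_excess S l (w, a) \<partial>\<pi> w)" for l w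
  have "\<forall>v\<in>space (state_law S \<Otimes>\<^sub>M actions S). \<bar>mean_excess S l v\<bar> \<le> C" for l
    using dC by blast
  note D_avg = policy_average[OF pol mean_excess_measurable this, folded D_def]
  have D_bound: "\<forall>w\<in>space (state_law S). \<bar>D l w\<bar> \<le> C" for l
    using D_avg(3) by blast
  have indep: "distr M (history_space S n \<Otimes>\<^sub>M state_law S) (\<lambda>x. (history \<omega> \<alpha> y T z n x, \<omega> n x))
      = distr M (history_space S n) (history \<omega> \<alpha> y T z n) \<Otimes>\<^sub>M state_law S" for n
    using run by (simp add: system_run_def)
  have QD_int: "integrable M (\<lambda>x. Q n l x * D l (\<omega> n x))"
    and QD: "(\<integral>x. Q n l x * D l (\<omega> n x) \<partial>M) = (\<integral>x. Q n l x \<partial>M) * (\<integral>w. D l w \<partial>state_law S)" for n l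
    using expectation_indep_product[OF M_prob state_prob history_measurable frame_measurable(1) indep
        history_queue_measurable D_avg(2) _ D_bound, folded Q_history] integrable_Q by blast+
  have Qd_int: "integrable M (\<lambda>x. Q n l x * mean_excess S l (\<omega> n x, \<alpha> n x))" for n l
  proof (rule Bochner_Integration.integrable_bound)
    show "integrable M (\<lambda>x. C * Q n l x)" using integrable_Q by simp
    have "\<bar>mean_excess S l (\<omega> n x, \<alpha> n x)\<bar> \<le> \<bar>C\<bar>" if "x \<in> space M" for x
      using dC[OF state_action_in_space[OF that]] by (rule order_trans) simp
    then show "AE x in M. norm (Q n l x * mean_excess S l (\<omega> n x, \<alpha> n x)) \<le> norm (C * Q n l x)"
      by (intro AE_I2) (simp add: abs_mult mult.commute[of "\<bar>C\<bar>"] mult_left_mono)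
  qed measurable
  have "(\<Sum>l\<in>UNIV. \<integral>x. Q n l x * X n l x \<partial>M) \<le> C1" for n
  proof -
    have "AE x in M. (\<Sum>l\<in>UNIV. Q n l x * mean_excess S l (\<omega> n x, \<alpha> n x)) \<le> C1 + (\<Sum>l\<in>UNIV. Q n l x * D l (\<omega> n x))"
      using drift AE_space
    proof eventually_elim
      case (elim x)
      have w: "\<omega> n x \<in> space (state_law S)"
        using measurable_space[OF frame_measurable(1) elim(2)] .
      interpret A: prob_space "\<pi> (\<omega> n x)" using policy_space(1)[OF pol w] .
      \<comment> \<open>The left integrand does not depend on \<open>a\<close>, so averaging over a
        probability measure leaves it unchanged.\<close>
      have "A.expectation (\<lambda>a. \<Sum>l\<in>UNIV. Q n l x * mean_excess S l (\<omega> n x, \<alpha> n x))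
          \<le> A.expectation (\<lambda>a. C1 + (\<Sum>l\<in>UNIV. Q n l x * mean_excess S l (\<omega> n x, a)))"
        using elim(1) D_avg(1)[OF w] policy_space(2)[OF pol w]
        by (intro integral_mono) auto
      then show ?case
        using D_avg(1)[OF w] by (simp add: A.prob_space D_def)
    qed
    then have "(\<integral>x. (\<Sum>l\<in>UNIV. Q n l x * mean_excess S l (\<omega> n x, \<alpha> n x)) \<partial>M)
        \<le> (\<integral>x. C1 + (\<Sum>l\<in>UNIV. Q n l x * D l (\<omega> n x)) \<partial>M)"
      using Qd_int QD_int by (intro integral_mono_AE) auto
    also have "\<dots> = C1 + (\<Sum>l\<in>UNIV. (\<integral>x. Q n l x \<partial>M) * (\<integral>w. D l w \<partial>state_law S))"
      using QD_int by (simp add: M.prob_space QD)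
    also have "\<dots> \<le> C1 + 0"
      using slack by (intro add_left_mono sum_nonpos mult_nonneg_nonpos)
        (auto simp: Q_nonneg D_def intro!: Bochner_Integration.integral_nonneg)
    finally show ?thesis
      using Qd_int by (simp add: expectation_Q_X(2))
  qed
  then show ?thesis by (rule that)
qed

text \<open>The drift bound concerns all queues together and says nothing about the sign or size of
  one summand. The induction therefore runs on the sum of the second moments, each of which is
  nonnegative and so below the sum.\<close>

lemma queue_second_moment:
  obtains C where "0 \<le> C" and "\<And>n l. (\<integral>x. (Q n l x)\<^sup>2 \<partial>M) \<le> C * real n"
proof -
  obtain C1 where C1: "\<And>n. (\<Sum>l\<in>UNIV. \<integral>x. Q n l x * X n l x \<partial>M) \<le> C1"
    by (rule expected_drift_bounded) blast
  obtain C2 where C2: "0 < C2" and X2: "\<And>n l. integrable M (\<lambda>x. (X n l x)\<^sup>2)" "\<And>n l. (\<integral>x. (X n l x)\<^sup>2 \<partial>M) \<le> C2"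
    by (rule X_second_moment) blast
  \<comment> \<open>The growth per frame: twice the drift bound from the cross term, and
    \<open>C2\<close> for each of the \<open>CARD('l)\<close> squared increments. The absolute value
    makes \<open>C\<close> nonnegative.\<close>
  define C where "C = 2 * \<bar>C1\<bar> + real CARD('l) * C2"
  have step: "(\<integral>x. (Q (Suc n) l x)\<^sup>2 \<partial>M)
      \<le> (\<integral>x. (Q n l x)\<^sup>2 \<partial>M) + 2 * (\<integral>x. Q n l x * X n l x \<partial>M) + (\<integral>x. (X n l x)\<^sup>2 \<partial>M)" for n l
  proof -
    have "(\<integral>x. (Q (Suc n) l x)\<^sup>2 \<partial>M) \<le> (\<integral>x. (Q n l x)\<^sup>2 + 2 * (Q n l x * X n l x) + (X n l x)\<^sup>2 \<partial>M)"
      using integrable_Q_square expectation_Q_X(1) X2(1)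
      by (intro integral_mono Bochner_Integration.integrable_add integrable_mult_right)
        (auto intro: Q_Suc_square)
    also have "\<dots> = (\<integral>x. (Q n l x)\<^sup>2 \<partial>M) + 2 * (\<integral>x. Q n l x * X n l x \<partial>M) + (\<integral>x. (X n l x)\<^sup>2 \<partial>M)"
      using integrable_Q_square[of n l] expectation_Q_X(1)[of n l] X2(1)[of n l] by simp
    finally show ?thesis .
  qed
  have total: "(\<Sum>l\<in>UNIV. \<integral>x. (Q n l x)\<^sup>2 \<partial>M) \<le> C * real n" for n
  proof (induction n)
    case 0
    show ?case by (simp add: Q_def)
  next
    case (Suc n)
    have "(\<Sum>l\<in>UNIV. \<integral>x. (Q (Suc n) l x)\<^sup>2 \<partial>M)
        \<le> (\<Sum>l\<in>UNIV. (\<integral>x. (Q n l x)\<^sup>2 \<partial>M) + 2 * (\<integral>x. Q n l x * X n l x \<partial>M) + C2)"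
      by (intro sum_mono order_trans[OF step] add_left_mono X2(2))
    also have "\<dots> = (\<Sum>l\<in>UNIV. \<integral>x. (Q n l x)\<^sup>2 \<partial>M) + 2 * (\<Sum>l\<in>UNIV. \<integral>x. Q n l x * X n l x \<partial>M) + real CARD('l) * C2"
      by (simp add: sum.distrib sum_distrib_left)
    also have "\<dots> \<le> C * real n + C"
      using Suc C1[of n] by (simp add: C_def)
    finally show ?case by (simp add: algebra_simps)
  qed
  show ?thesis
  proof
    show "0 \<le> C" using C2 by (simp add: C_def)
    fix n l
    have "(\<integral>x. (Q n l x)\<^sup>2 \<partial>M) \<le> (\<Sum>l\<in>UNIV. \<integral>x. (Q n l x)\<^sup>2 \<partial>M)"
      by (rule member_le_sum) auto
    then show "(\<integral>x. (Q n l x)\<^sup>2 \<partial>M) \<le> C * real n"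
      using total[of n] by linarith
  qed
qed

section \<open>Almost sure decay of the queues and the constraints\<close>

lemma AE_queue_rate_zero: "AE x in M. (\<lambda>n. Q n l x / real n) \<longlonglongrightarrow> 0"
proof -
  obtain C1 where C1: "0 \<le> C1" and Q2: "\<And>n l. (\<integral>x. (Q n l x)\<^sup>2 \<partial>M) \<le> C1 * real n"
    by (rule queue_second_moment) blast
  obtain C2 where C2: "0 < C2" and X2: "\<And>n l. integrable M (\<lambda>x. (X n l x)\<^sup>2)" "\<And>n l. (\<integral>x. (X n l x)\<^sup>2 \<partial>M) \<le> C2"
    by (rule X_second_moment) blast
  \<comment> \<open>\<open>R k\<close> dominates the queue on the whole block from k^2 up to, but
    excluding, (k+1)^2.\<close>
  define R where "R k x = Q (k\<^sup>2) l x + (\<Sum>i\<in>{k\<^sup>2..<(Suc k)\<^sup>2}. \<bar>X i l x\<bar>)" for k x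
  have [measurable]: "R k \<in> borel_measurable M" for k
    unfolding R_def by measurable
  have R_nonneg: "0 \<le> R k x" for k x
    unfolding R_def by (intro add_nonneg_nonneg Q_nonneg sum_nonneg) auto
  have card: "card {k\<^sup>2..<(Suc k)\<^sup>2} = 2 * k + 1" for k :: nat
    by (simp add: power2_eq_square)
  \<comment> \<open>An upper bound for \<open>(R k x)\<^sup>2\<close> built from single squares: (a
    + b)^2 \<le> 2 a^2 + 2 b^2, then Cauchy-Schwarz over the 2k+1 increments of the block.\<close>
  define F where "F k x = 2 * (Q (k\<^sup>2) l x)\<^sup>2 + 2 * ((\<Sum>i\<in>{k\<^sup>2..<(Suc k)\<^sup>2}. (X i l x)\<^sup>2) * real (2 * k + 1))" for k x
  have R_le_F: "(R k x)\<^sup>2 \<le> F k x" for k x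
  proof -
    have "(R k x)\<^sup>2 \<le> 2 * (Q (k\<^sup>2) l x)\<^sup>2 + 2 * (\<Sum>i\<in>{k\<^sup>2..<(Suc k)\<^sup>2}. \<bar>X i l x\<bar>)\<^sup>2"
      unfolding R_def using sum_squares_bound[of "Q (k\<^sup>2) l x" "\<Sum>i\<in>{k\<^sup>2..<(Suc k)\<^sup>2}. \<bar>X i l x\<bar>"]
      by (simp add: power2_sum)
    moreover have "(\<Sum>i\<in>{k\<^sup>2..<(Suc k)\<^sup>2}. \<bar>X i l x\<bar>)\<^sup>2 \<le> (\<Sum>i\<in>{k\<^sup>2..<(Suc k)\<^sup>2}. (X i l x)\<^sup>2) * real (2 * k + 1)"
      using sum_squared_le_sum_of_squares[of "\<lambda>i. \<bar>X i l x\<bar>" "{k\<^sup>2..<(Suc k)\<^sup>2}"] unfolding card by simp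
    ultimately show ?thesis
      by (simp add: F_def)
  qed
  have F_int: "integrable M (F k)" for k
    unfolding F_def using integrable_Q_square X2(1) by (intro Bochner_Integration.integrable_add integrable_mult_right
        integrable_mult_left Bochner_Integration.integrable_sum) auto
  have R_int: "integrable M (\<lambda>x. (R k x)\<^sup>2)" for k
  proof (rule Bochner_Integration.integrable_bound[OF F_int[of k]])
    show "AE x in M. norm ((R k x)\<^sup>2) \<le> norm (F k x)"
      using R_le_F by (intro AE_I2) (simp add: order_trans[OF _ abs_ge_self])
  qed measurable
  \<comment> \<open>For k \<ge> 1 one has 2k + 1 \<le> 3k, so the block contributes 2 * C2 * (3k)^2,
    which is the 18.\<close>
  have F_le: "(\<integral>x. F k x \<partial>M) \<le> (2 * C1 + 18 * C2) * (real k)\<^sup>2" if "0 < k" for k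
  proof -
    have "(\<integral>x. F k x \<partial>M)
        = 2 * (\<integral>x. (Q (k\<^sup>2) l x)\<^sup>2 \<partial>M) + 2 * ((\<Sum>i\<in>{k\<^sup>2..<(Suc k)\<^sup>2}. \<integral>x. (X i l x)\<^sup>2 \<partial>M) * real (2 * k + 1))"
      unfolding F_def using integrable_Q_square X2(1) by (simp add: Bochner_Integration.integral_add)
    also have "\<dots> \<le> 2 * (C1 * real (k\<^sup>2)) + 2 * ((\<Sum>i\<in>{k\<^sup>2..<(Suc k)\<^sup>2}. C2) * real (2 * k + 1))"
      by (intro add_mono mult_left_mono mult_right_mono sum_mono Q2 X2(2)) auto
    also have "\<dots> = 2 * C1 * (real k)\<^sup>2 + 2 * C2 * (real (2 * k + 1))\<^sup>2"
      by (simp only: sum_constant card) (simp add: power2_eq_square)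
    also have "\<dots> \<le> 2 * C1 * (real k)\<^sup>2 + 2 * C2 * (3 * real k)\<^sup>2"
      using C2 that by (intro add_left_mono mult_left_mono power_mono) auto
    finally show ?thesis by (simp add: algebra_simps power_mult_distrib)
  qed
  have "AE x in M. (\<lambda>k. (R k x / (real k)\<^sup>2)\<^sup>2) \<longlonglongrightarrow> 0"
  proof (rule AE_tendsto_zero_of_summable_expectation)
    show "summable (\<lambda>k. (2 * C1 + 18 * C2) * inverse (real k ^ 2))"
      by (intro summable_mult inverse_power_summable) simp
    show "integrable M (\<lambda>x. (R k x / (real k)\<^sup>2)\<^sup>2)" for k
      using R_int by (simp add: power_divide)
    show "(\<integral>x. (R k x / (real k)\<^sup>2)\<^sup>2 \<partial>M) \<le> (2 * C1 + 18 * C2) * inverse (real k ^ 2)" for k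
    \<comment> \<open>At k = 0 both sides are 0, because division by 0 gives 0.\<close>
    proof (cases "k = 0")
      case False
      have "(\<integral>x. (R k x)\<^sup>2 \<partial>M) \<le> (\<integral>x. F k x \<partial>M)"
        by (intro integral_mono R_int F_int R_le_F)
      also have "\<dots> \<le> (2 * C1 + 18 * C2) * (real k)\<^sup>2"
        using False by (intro F_le) simp
      finally show ?thesis
        using False by (simp add: power_divide divide_simps power2_eq_square)
    qed simp
  qed simp
  then show ?thesis
  proof eventually_elim
    case (elim x)
    show ?case
    proof (rule tendsto_zero_of_square_blocks[OF Q_nonneg])
      show "(\<lambda>k. R k x / (real k)\<^sup>2) \<longlonglongrightarrow> 0"
        \<comment> \<open>The root of the square is the quotient itself, since \<open>R\<close> is
          nonnegative.\<close>
        using tendsto_real_sqrt[OF elim] R_nonneg by simp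
      fix k n :: nat assume kn: "k\<^sup>2 \<le> n" "n < (Suc k)\<^sup>2"
      have "Q n l x \<le> Q (k\<^sup>2) l x + (\<Sum>i\<in>{k\<^sup>2..<n}. \<bar>X i l x\<bar>)"
        unfolding Q_def X_def by (rule queue_le_add_sum[OF kn(1)])
      also have "\<dots> \<le> R k x"
        unfolding R_def using kn by (intro add_left_mono sum_mono2) auto
      finally show "Q n l x \<le> R k x" .
    qed
  qed
qed

text \<open>After division by the total frame length the excess over \<open>bound S $ l\<close> is
  at most the queue over that length. Frames of length at least 1 make the total at least
  \<open>N\<close>, so this is below \<open>Q N l x / real N\<close>, which tends to 0.\<close>

lemma AE_resource_constraint:
  "AE x in M. limsup (\<lambda>N. ereal ((\<Sum>n<N. z n x $ l) / (\<Sum>n<N. T n x))) \<le> ereal (bound S $ l)"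
proof -
  have "AE x in M. \<forall>n. 1 \<le> T n x"
    using AE_frame_length by (simp add: AE_all_countable)
  with AE_queue_rate_zero[of l] show ?thesis
  proof eventually_elim
    case (elim x)
    have "\<forall>\<^sub>F N in sequentially. ereal ((\<Sum>n<N. z n x $ l) / (\<Sum>n<N. T n x))
        \<le> ereal (bound S $ l + Q N l x / real N)"
    proof (rule eventually_sequentiallyI[where c = 1])
      fix N :: nat assume N: "1 \<le> N"
      have "(\<Sum>n<N. 1) \<le> (\<Sum>n<N. T n x)"
        using elim(2) by (intro sum_mono) auto
      then have T: "real N \<le> (\<Sum>n<N. T n x)" by simp
      have "(\<Sum>n<N. z n x $ l) \<le> Q N l x + bound S $ l * (\<Sum>n<N. T n x)"
        unfolding Q_def by (rule sum_le_queue)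
      then have "(\<Sum>n<N. z n x $ l) / (\<Sum>n<N. T n x) \<le> bound S $ l + Q N l x / (\<Sum>n<N. T n x)"
        using N T by (simp add: field_simps)
      also have "\<dots> \<le> bound S $ l + Q N l x / real N"
        using N T by (intro add_left_mono divide_left_mono Q_nonneg) auto
      finally show "ereal ((\<Sum>n<N. z n x $ l) / (\<Sum>n<N. T n x)) \<le> ereal (bound S $ l + Q N l x / real N)"
        by simp
    qed
    then have "limsup (\<lambda>N. ereal ((\<Sum>n<N. z n x $ l) / (\<Sum>n<N. T n x)))
        \<le> limsup (\<lambda>N. ereal (bound S $ l + Q N l x / real N))"
      by (rule Limsup_mono)
    also have "\<dots> = ereal (bound S $ l + 0)"
      by (intro lim_imp_Limsup tendsto_intros elim(1)) simp
    finally show ?case by simp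
  qed
qed

end

theorem theorem1:
  fixes S :: "('q::finite, 'a, 'l::finite) renewal_system"
    and V \<delta> \<theta>max :: real
    and M :: "'p measure"
    and \<omega> :: "nat \<Rightarrow> 'p \<Rightarrow> real ^ 'q"
    and \<alpha> :: "nat \<Rightarrow> 'p \<Rightarrow> 'a"
    and y T :: "nat \<Rightarrow> 'p \<Rightarrow> real"
    and z :: "nat \<Rightarrow> 'p \<Rightarrow> real ^ 'l"
  assumes "V > 0" and "\<delta> > 0"
    and "is_renewal_system S"
    and "exponential_type S"
    and "\<theta>max > 0" and "0 \<le> optimal_objective S" and "optimal_objective S < ereal \<theta>max"
    and "compact_means S"
    and "bounded_averages S"
    and "xi_slackness S"
    and "system_run S M \<omega> \<alpha> y T z"
    and "follows_algorithm S V \<delta> \<theta>max M \<omega> \<alpha> y T z"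
  shows "(\<forall>n. \<forall>x\<in>space M. \<alpha> n x \<in> space (actions S)) \<and>
         (AE x in M. \<forall>l. limsup (\<lambda>N. ereal ((\<Sum>n<N. z n x $ l) / (\<Sum>n<N. T n x)))
                           \<le> ereal (bound S $ l))"
proof -
  interpret algorithm_run S M \<omega> \<alpha> y T z V \<delta> \<theta>max
    by unfold_locales (use assms in auto)
  show ?thesis
    \<comment> \<open>There are finitely many resources, so the exceptional null sets of the single
      constraints can be united.\<close>
    using AE_resource_constraint measurable_space[OF frame_measurable(2)]
    by (auto simp: AE_all_countable)
qed

end
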